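(* Let $\gamma,\gamma^\dagger\in D(F)$ satisfy $\left\|\frac{\gamma-\gamma^\dagger}{\gamma^\dagger}\right\|_{L^\infty}<1$, and set $B(\gamma,\gamma^\dagger):=\Lambda_\gamma-\Lambda_{\gamma^\dagger}-\Lambda'_\gamma(\gamma-\gamma^\dagger)$ and $\Delta\gamma:=(\gamma-\gamma^\dagger)/(\gamma^\dagger)^{1/2}$. Then: (i) for every $f\in H^{1/2}(\partial\Omega)$, $$\langle B(\gamma,\gamma^\dagger)f,f\rangle\le\inf\Big\{\|\Delta\gamma\,\nabla u_{\gamma,f}-w\|_{L^2(\Omega)^n}^2:\ w\in L^2(\Omega)^n,\ \operatorname{div}((\gamma^\dagger)^{1/2}w)=0\Big\};$$ (ii) $B(\gamma,\gamma^\dagger)\preceq\Lambda'_\gamma\!\left(\frac{|\gamma-\gamma^\dagger|^2}{\gamma^\dagger}\right)-(\Lambda_\gamma-\Lambda_{\gamma^\dagger})\Lambda_{\gamma^\dagger}^{-1}(\Lambda_\gamma-\Lambda_{\gamma^\dagger})$; (iii) $B(\gamma,\gamma^\dagger)\preceq\Lambda'_\gamma\!\left(\frac{|\gamma-\gamma^\dagger|^2}{\gamma^\dagger}\right)-\Lambda'_\gamma\!\left(\frac{(\gamma-\gamma^\dagger)\gamma}{\gamma^\dagger}\right)\Big[\Lambda'_\gamma\!\left(\frac{\gamma^2}{\gamma^\dagger}\right)\Big]^{-1}\Lambda'_\gamma\!\left(\frac{(\gamma-\gamma^\dagger)\gamma}{\gamma^\dagger}\right)$. (Equivalently, (ii)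 and (iii) state that for all $f,g\in H^{1/2}(\partial\Omega)$: $\langle Bf,f\rangle\le\langle\Lambda'_\gamma(\frac{|\gamma-\gamma^\dagger|^2}{\gamma^\dagger})f,f\rangle-2\langle(\Lambda_\gamma-\Lambda_{\gamma^\dagger})f,g\rangle+\langle\Lambda_{\gamma^\dagger}g,g\rangle$, respectively $\langle Bf,f\rangle\le\langle\Lambda'_\gamma(\frac{|\gamma-\gamma^\dagger|^2}{\gamma^\dagger})f,f\rangle-2\langle\Lambda'_\gamma(\frac{(\gamma-\gamma^\dagger)\gamma}{\gamma^\dagger})f,g\rangle+\langle\Lambda'_\gamma(\frac{\gamma^2}{\gamma^\dagger})g,g\rangle$.)
   Context: Let $\Omega\subset\mathbb{R}^n$ be a bounded Lipschitz domain and $0<\underline{\alpha}\le\overline{\alpha}$ fixed constants. A conductivity is a function $\gamma\in L^\infty(\Omega)$ with $\underline{\alpha}\le\gamma\le\overline{\alpha}$ a.e. For a conductivity $\gamma$ and $f\in H^{1/2}(\partial\Omega)$, $u_{\gamma,f}\in H^1(\Omega)$ is the weak solution of $\operatorname{div}(\gamma\nabla u)=0$ in $\Omega$, $u=f$ on $\partial\Omega$. Boundary data are considered modulo additive constants, and $H^{1/2}(\partial\Omega)$ carries the Hilbert norm $\|f\|:=\|\nabla u_{1,f}\|_{L^2(\Omega)^n}$; $\langle\cdot,\cdot\rangle$ is the duality pairing of $H^{-1/2}(\partial\Omega)$ with $H^{1/2}(\partial\Omega)$. The Dirichlet-to-Neumann map $\Lambda_\gamma:H^{1/2}(\partial\Omega)\to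 H^{-1/2}(\partial\Omega)$ is the bounded symmetric operator with $\langle\Lambda_\gamma f,g\rangle=\int_\Omega\gamma\nabla u_{\gamma,f}\cdot\nabla u_{\gamma,g}\,dx$; for conductivities $\gamma_1,\gamma_2$ one has $\langle(\Lambda_{\gamma_1}-\Lambda_{\gamma_2})f,g\rangle=\int_\Omega(\gamma_1-\gamma_2)\nabla u_{\gamma_1,f}\cdot\nabla u_{\gamma_2,g}\,dx$. For $w\in L^\infty(\Omega)$, $\Lambda'_\gamma(w)$ denotes the symmetric operator with $\langle\Lambda'_\gamma(w)f,g\rangle=\int_\Omega w\,\nabla u_{\gamma,f}\cdot\nabla u_{\gamma,g}\,dx$ (the Fréchet derivative of $\gamma\mapsto\Lambda_\gamma$ at $\gamma$ in direction $w$). On $H^{1/2}(\partial\Omega)$ modulo constants, $\Lambda_{\gamma^\dagger}$ and $\Lambda'_\gamma(\gamma^2/\gamma^\dagger)$ are coercive and hence invertible onto the annihilator of constants in $H^{-1/2}(\partial\Omega)$; their inverses are meant in this sense. For symmetric bounded operators $A,B:H^{1/2}(\partial\Omega)\to H^{-1/2}(\partial\Omega)$, $A\preceq B$ (Löwner order) means $\langle Af,f\rangle\le\langle Bf,f\rangle$ for all $f$. Let $(f_i)_{i\in I}$ be a finite or countably infinite orthonormal family in $H^{1/2}(\partial\Omega)$. For a symmetric operator $A:H^{1/2}\to H^{-1/2}$ put $\|A\|_Y^2:=\sum_{i,j\in I}|\langle Af_i,f_j\rangle|^2\in[0,\infty]$. Let $D(F)$ be the set of conductivities $\gamma$ with $\|\Lambda_\gamma-\Lambda_1\|_Y<\infty$.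 *)

theory Defs
  imports "HOL-Analysis.Analysis"
begin

definition lipschitz_domain :: "'a::euclidean_space set \<Rightarrow> bool" where
  "lipschitz_domain \<Omega> \<longleftrightarrow> open \<Omega> \<and> connected \<Omega> \<and> \<Omega> \<noteq> {} \<and> bounded \<Omega> \<and>
     (\<forall>x\<in>frontier \<Omega>. \<exists>(e::'a) r L (h::'a \<Rightarrow> real). norm e = 1 \<and> r > 0 \<and>
        L-lipschitz_on UNIV h \<and>
        \<Omega> \<inter> ball x r = {y \<in> ball x r. y \<bullet> e < h (y - (y \<bullet> e) *\<^sub>R e)})"

definition L2_on :: "'a::euclidean_space set \<Rightarrow> ('a \<Rightarrow> 'b::real_normed_vector) \<Rightarrow> bool" where
  "L2_on \<Omega> u \<longleftrightarrow> u \<in> borel_measurable (lebesgue_on \<Omega>) \<and>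
     integrable (lebesgue_on \<Omega>) (\<lambda>x. (norm (u x))\<^sup>2)"

definition test_fun :: "'a::euclidean_space set \<Rightarrow> ('a \<Rightarrow> real) \<Rightarrow> ('a \<Rightarrow> 'a) \<Rightarrow> bool" where
  "test_fun \<Omega> \<phi> D\<phi> \<longleftrightarrow> (\<forall>x. (\<phi> has_derivative (\<lambda>h. D\<phi> x \<bullet> h)) (at x)) \<and>
     continuous_on UNIV D\<phi> \<and> compact (closure {x. \<phi> x \<noteq> 0}) \<and> closure {x. \<phi> x \<noteq> 0} \<subseteq> \<Omega>"

definition weak_grad :: "'a::euclidean_space set \<Rightarrow> ('a \<Rightarrow> real) \<Rightarrow> ('a \<Rightarrow> 'a) \<Rightarrow> bool" where
  "weak_grad \<Omega> u G \<longleftrightarrow> (\<forall>\<phi> D\<phi>. test_fun \<Omega> \<phi> D\<phi> \<longrightarrow>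
     integral\<^sup>L (lebesgue_on \<Omega>) (\<lambda>x. u x *\<^sub>R D\<phi> x) =
       - integral\<^sup>L (lebesgue_on \<Omega>) (\<lambda>x. \<phi> x *\<^sub>R G x))"

definition H1 :: "'a::euclidean_space set \<Rightarrow> ('a \<Rightarrow> real) \<Rightarrow> bool" where
  "H1 \<Omega> u \<longleftrightarrow> L2_on \<Omega> u \<and> (\<exists>G. L2_on \<Omega> G \<and> weak_grad \<Omega> u G)"

text \<open>The weak gradient (unique up to null sets).\<close>
definition grad :: "'a::euclidean_space set \<Rightarrow> ('a \<Rightarrow> real) \<Rightarrow> 'a \<Rightarrow> 'a" where
  "grad \<Omega> u = (SOME G. L2_on \<Omega> G \<and> weak_grad \<Omega> u G)"

definition H1_0 :: "'a::euclidean_space set \<Rightarrow> ('a \<Rightarrow> real) \<Rightarrow> bool" where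
  "H1_0 \<Omega> u \<longleftrightarrow> H1 \<Omega> u \<and> (\<exists>\<phi> D\<phi>. (\<forall>k::nat. test_fun \<Omega> (\<phi> k) (D\<phi> k)) \<and>
     ((\<lambda>k. integral\<^sup>L (lebesgue_on \<Omega>) (\<lambda>x. (u x - \<phi> k x)\<^sup>2)
         + integral\<^sup>L (lebesgue_on \<Omega>) (\<lambda>x. (norm (grad \<Omega> u x - D\<phi> k x))\<^sup>2)) \<longlonglongrightarrow> 0))"

definition conductivity :: "'a::euclidean_space set \<Rightarrow> real \<Rightarrow> real \<Rightarrow> ('a \<Rightarrow> real) \<Rightarrow> bool" where
  "conductivity \<Omega> lo hi \<gamma> \<longleftrightarrow> \<gamma> \<in> borel_measurable (lebesgue_on \<Omega>) \<and>
     (AE x in lebesgue_on \<Omega>. lo \<le> \<gamma> x \<and> \<gamma> x \<le> hi)"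

text \<open>Boundary data f in H^{1/2}(boundary) are represented by any F in H^1(\<Omega>) with
  trace f.  u is the weak solution of div(\<gamma> grad u) = 0 with u - F in H^1_0.\<close>
definition is_sol :: "'a::euclidean_space set \<Rightarrow> ('a \<Rightarrow> real) \<Rightarrow> ('a \<Rightarrow> real) \<Rightarrow> ('a \<Rightarrow> real) \<Rightarrow> bool" where
  "is_sol \<Omega> \<gamma> F u \<longleftrightarrow> H1 \<Omega> u \<and> H1_0 \<Omega> (\<lambda>x. u x - F x) \<and>
     (\<forall>v. H1_0 \<Omega> v \<longrightarrow>
        integral\<^sup>L (lebesgue_on \<Omega>) (\<lambda>x. \<gamma> x * (grad \<Omega> u x \<bullet> grad \<Omega> v x)) = 0)"

definition sol :: "'a::euclidean_space set \<Rightarrow> ('a \<Rightarrow> real) \<Rightarrow> ('a \<Rightarrow> real) \<Rightarrow> 'a \<Rightarrow> real" where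
  "sol \<Omega> \<gamma> F = (SOME u. is_sol \<Omega> \<gamma> F u)"

text \<open>Bilinear form of the Dirichlet-to-Neumann map: <Lambda_gamma f, g>.\<close>
definition DN :: "'a::euclidean_space set \<Rightarrow> ('a \<Rightarrow> real) \<Rightarrow> ('a \<Rightarrow> real) \<Rightarrow> ('a \<Rightarrow> real) \<Rightarrow> real" where
  "DN \<Omega> \<gamma> F G = integral\<^sup>L (lebesgue_on \<Omega>)
     (\<lambda>x. \<gamma> x * (grad \<Omega> (sol \<Omega> \<gamma> F) x \<bullet> grad \<Omega> (sol \<Omega> \<gamma> G) x))"

text \<open>Bilinear form of the Frechet derivative: <Lambda'_gamma(w) f, g>.\<close>
definition DNd :: "'a::euclidean_space set \<Rightarrow> ('a \<Rightarrow> real) \<Rightarrow> ('a \<Rightarrow> real) \<Rightarrow> ('a \<Rightarrow> real) \<Rightarrow> ('a \<Rightarrow> real) \<Rightarrow> real" where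
  "DNd \<Omega> \<gamma> w F G = integral\<^sup>L (lebesgue_on \<Omega>)
     (\<lambda>x. w x * (grad \<Omega> (sol \<Omega> \<gamma> F) x \<bullet> grad \<Omega> (sol \<Omega> \<gamma> G) x))"

text \<open>Orthonormal family (f_i), i in I (I a subset of nat, i.e. finite or countable),
  w.r.t. the inner product of H^{1/2} induced by the norm ||grad u_{1,f}||.\<close>
definition orthonormal_fam :: "'a::euclidean_space set \<Rightarrow> nat set \<Rightarrow> (nat \<Rightarrow> 'a \<Rightarrow> real) \<Rightarrow> bool" where
  "orthonormal_fam \<Omega> I fam \<longleftrightarrow> (\<forall>i\<in>I. H1 \<Omega> (fam i)) \<and>
     (\<forall>i\<in>I. \<forall>j\<in>I. DN \<Omega> (\<lambda>_. 1) (fam i) (fam j) = (if i = j then 1 else 0))"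

text \<open>D(F): conductivities with ||Lambda_gamma - Lambda_1||_Y finite.\<close>
definition in_DF :: "'a::euclidean_space set \<Rightarrow> real \<Rightarrow> real \<Rightarrow> nat set \<Rightarrow> (nat \<Rightarrow> 'a \<Rightarrow> real) \<Rightarrow> ('a \<Rightarrow> real) \<Rightarrow> bool" where
  "in_DF \<Omega> lo hi I fam \<gamma> \<longleftrightarrow> conductivity \<Omega> lo hi \<gamma> \<and>
     (\<lambda>(i,j). (DN \<Omega> \<gamma> (fam i) (fam j) - DN \<Omega> (\<lambda>_. 1) (fam i) (fam j))\<^sup>2) summable_on (I \<times> I)"

definition div_free :: "'a::euclidean_space set \<Rightarrow> ('a \<Rightarrow> 'a) \<Rightarrow> bool" where
  "div_free \<Omega> v \<longleftrightarrow> (\<forall>\<phi> D\<phi>. test_fun \<Omega> \<phi> D\<phi> \<longrightarrow>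
     integral\<^sup>L (lebesgue_on \<Omega>) (\<lambda>x. v x \<bullet> D\<phi> x) = 0)"

definition Bform :: "'a::euclidean_space set \<Rightarrow> ('a \<Rightarrow> real) \<Rightarrow> ('a \<Rightarrow> real) \<Rightarrow> ('a \<Rightarrow> real) \<Rightarrow> ('a \<Rightarrow> real) \<Rightarrow> real" where
  "Bform \<Omega> \<gamma> \<gamma>d F G = DN \<Omega> \<gamma> F G - DN \<Omega> \<gamma>d F G - DNd \<Omega> \<gamma> (\<lambda>x. \<gamma> x - \<gamma>d x) F G"

end

theory Submission
  imports Defs
begin

text \<open>
  Let \<open>z = u - v\<close> be the difference of the solutions for \<open>\<gamma>\<close> and \<open>\<gamma>d\<close> with the same boundary data \<open>F\<close>.
  Since \<open>z\<close> vanishes on the boundary, it may be used as a test function in both equations; this gives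
  \<open>B(F, F) = \<integral> \<gamma>d |\<nabla>z|\<^sup>2\<close> and, for every admissible \<open>w\<close>,
  \<open>\<integral> X \<bullet> Y = - \<integral> |Y|\<^sup>2\<close>, where \<open>X = (\<gamma> - \<gamma>d) / sqrt \<gamma>d \<nabla>u - w\<close> and \<open>Y = sqrt \<gamma>d \<nabla>z\<close>.
  Part (i) is then \<open>0 \<le> \<integral> |X + Y|\<^sup>2\<close>; parts (ii) and (iii) are the choices
  \<open>w = sqrt \<gamma>d \<nabla>u\<close> with the \<open>\<gamma>d\<close>-solution for \<open>G\<close>, and \<open>w = \<gamma> / sqrt \<gamma>d \<nabla>u\<close>
  with the \<open>\<gamma>\<close>-solution for \<open>G\<close>.

  As gradients and solutions are picked by Hilbert choice, the argument rests on the almost everywhere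
  uniqueness of weak gradients (indicators of open sets are bounded pointwise limits of test functions)
  and on the existence of solutions (a minimising sequence of the energy among test functions is
  Cauchy by the parallelogram identity and the Poincare inequality).
\<close>

section \<open>Square-integrable functions\<close>

text \<open>In (i) the pairing of \<open>X\<close> with \<open>Y\<close> is the same for every
  admissible \<open>w\<close>, because sqrt \<gamma>d w is divergence free and z vanishes on the
  boundary; this is why one computation serves the whole infimum. The inverses in (ii) and (iii) are
  never formed: for a coercive A and symmetric T, the supremum over g of 2<Tf,g> - <Ag,g> is <T A^-1
  T f, f>. Each operator inequality thus becomes a family indexed by \<open>G\<close>, and every
  \<open>G\<close> supplies one competitor \<open>w\<close> in (i). The obstacle is a mismatch of
  test classes: \<open>div_free\<close> and \<open>weak_grad\<close> are tested with compactly
  supported C^1 functions, whereas \<open>is_sol\<close> is tested with the chosen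
  \<open>grad\<close> of every element of H^1_0. Density bridges the two, and every exchange of one
  gradient for another holds only almost everywhere. That test functions are merely C^1 is
  exploited: they are built explicitly from squared positive parts and rational functions, without
  mollification.\<close>

definition weighted_inner :: "'a::euclidean_space set \<Rightarrow> ('a \<Rightarrow> real) \<Rightarrow> ('a \<Rightarrow> 'b::euclidean_space) \<Rightarrow> ('a \<Rightarrow> 'b) \<Rightarrow> real" where
  "weighted_inner \<Omega> a f g = integral\<^sup>L (lebesgue_on \<Omega>) (\<lambda>x. a x * (f x \<bullet> g x))"

definition Linf_on :: "'a::euclidean_space set \<Rightarrow> ('a \<Rightarrow> real) \<Rightarrow> bool" where
  "Linf_on \<Omega> a \<longleftrightarrow> a \<in> borel_measurable (lebesgue_on \<Omega>) \<and> (\<exists>C. AE x in lebesgue_on \<Omega>. \<bar>a x\<bar> \<le> C)"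

lemma L2_on_measurable: "L2_on \<Omega> f \<Longrightarrow> f \<in> borel_measurable (lebesgue_on \<Omega>)"
  by (simp add: L2_on_def)

lemma Linf_on_measurable: "Linf_on \<Omega> f \<Longrightarrow> f \<in> borel_measurable (lebesgue_on \<Omega>)"
  by (simp add: Linf_on_def)

lemma Linf_on_const: "Linf_on \<Omega> (\<lambda>x. c)"
  by (auto simp: Linf_on_def)

lemma Linf_on_mult:
  assumes "Linf_on \<Omega> a" "Linf_on \<Omega> b"
  shows "Linf_on \<Omega> (\<lambda>x. a x * b x)"
proof -
  obtain C D where C: "AE x in lebesgue_on \<Omega>. \<bar>a x\<bar> \<le> C" and D: "AE x in lebesgue_on \<Omega>. \<bar>b x\<bar> \<le> D"
    using assms by (auto simp: Linf_on_def)
  have "AE x in lebesgue_on \<Omega>. \<bar>a x * b x\<bar> \<le> \<bar>C\<bar> * \<bar>D\<bar>"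
    using C D by eventually_elim (auto simp: abs_mult intro!: mult_mono)
  then show ?thesis using assms by (auto simp: Linf_on_def)
qed

lemma Linf_on_diff:
  assumes "Linf_on \<Omega> a" "Linf_on \<Omega> b"
  shows "Linf_on \<Omega> (\<lambda>x. a x - b x)"
proof -
  obtain C D where C: "AE x in lebesgue_on \<Omega>. \<bar>a x\<bar> \<le> C" and D: "AE x in lebesgue_on \<Omega>. \<bar>b x\<bar> \<le> D"
    using assms by (auto simp: Linf_on_def)
  have "AE x in lebesgue_on \<Omega>. \<bar>a x - b x\<bar> \<le> C + D"
    using C D by eventually_elim auto
  then show ?thesis using assms by (auto simp: Linf_on_def)
qed

lemma conductivity_AE: "conductivity \<Omega> lo hi a \<Longrightarrow> AE x in lebesgue_on \<Omega>. lo \<le> a x \<and> a x \<le> hi"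
  by (simp add: conductivity_def)

lemma Linf_on_conductivity:
  assumes "conductivity \<Omega> lo hi a" "0 < lo" shows "Linf_on \<Omega> a"
proof -
  have "AE x in lebesgue_on \<Omega>. \<bar>a x\<bar> \<le> hi"
    using conductivity_AE[OF assms(1)] by eventually_elim (use assms(2) in auto)
  then show ?thesis using assms by (auto simp: Linf_on_def conductivity_def)
qed

lemma Linf_on_sqrt_conductivity: 
  assumes "conductivity \<Omega> lo hi a" "0 < lo" shows "Linf_on \<Omega> (\<lambda>x. sqrt (a x))"
proof -
  have "AE x in lebesgue_on \<Omega>. \<bar>sqrt (a x)\<bar> \<le> sqrt hi"
    using conductivity_AE[OF assms(1)] by eventually_elim (use assms(2) in auto)
  then show ?thesis using assms by (auto simp: Linf_on_def conductivity_def)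
qed

lemma Linf_on_inverse_sqrt_conductivity: 
  assumes "conductivity \<Omega> lo hi a" "0 < lo" shows "Linf_on \<Omega> (\<lambda>x. 1 / sqrt (a x))"
proof -
  have "AE x in lebesgue_on \<Omega>. \<bar>1 / sqrt (a x)\<bar> \<le> 1 / sqrt lo"
    using conductivity_AE[OF assms(1)] by eventually_elim (use assms(2) in \<open>auto intro!: divide_left_mono\<close>)
  then show ?thesis using assms by (auto simp: Linf_on_def conductivity_def)
qed

lemma L2_on_integrable_norms:
  fixes f :: "'a::euclidean_space \<Rightarrow> 'b::euclidean_space" and g :: "'a \<Rightarrow> 'c::euclidean_space"
  assumes "L2_on \<Omega> f" "L2_on \<Omega> g"
  shows "integrable (lebesgue_on \<Omega>) (\<lambda>x. norm (f x) * norm (g x))"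
proof (rule Bochner_Integration.integrable_bound)
  show "integrable (lebesgue_on \<Omega>) (\<lambda>x. (norm (f x))\<^sup>2 + (norm (g x))\<^sup>2)"
    using assms by (auto simp: L2_on_def)
  show "AE x in lebesgue_on \<Omega>. norm (norm (f x) * norm (g x)) \<le> norm ((norm (f x))\<^sup>2 + (norm (g x))\<^sup>2)"
  proof (intro AE_I2)
    fix x
    have "2 * norm (f x) * norm (g x) \<le> (norm (f x))\<^sup>2 + (norm (g x))\<^sup>2"
      by (rule sum_squares_bound)
    moreover have "0 \<le> norm (f x) * norm (g x)" by simp
    ultimately have "norm (f x) * norm (g x) \<le> (norm (f x))\<^sup>2 + (norm (g x))\<^sup>2"
      unfolding mult.assoc by linarith
    then show "norm (norm (f x) * norm (g x)) \<le> norm ((norm (f x))\<^sup>2 + (norm (g x))\<^sup>2)"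
      by simp
  qed
qed (use assms in \<open>auto simp: L2_on_def\<close>)

lemma L2_on_integrable_scaleR:
  fixes f :: "'a::euclidean_space \<Rightarrow> real" and g :: "'a \<Rightarrow> 'b::euclidean_space"
  assumes "L2_on \<Omega> f" "L2_on \<Omega> g"
  shows "integrable (lebesgue_on \<Omega>) (\<lambda>x. f x *\<^sub>R g x)"
  by (rule Bochner_Integration.integrable_bound[OF L2_on_integrable_norms[OF assms]])
     (use assms in \<open>auto simp: L2_on_def\<close>)

lemma L2_on_integrable_inner:
  fixes f g :: "'a::euclidean_space \<Rightarrow> 'b::euclidean_space"
  assumes "L2_on \<Omega> f" "L2_on \<Omega> g"
  shows "integrable (lebesgue_on \<Omega>) (\<lambda>x. f x \<bullet> g x)"
  by (rule Bochner_Integration.integrable_bound[OF L2_on_integrable_norms[OF assms]])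
     (use assms Cauchy_Schwarz_ineq2 in \<open>auto simp: L2_on_def\<close>)

lemma L2_on_scaleR_Linf:
  fixes f :: "'a::euclidean_space \<Rightarrow> 'b::euclidean_space"
  assumes a: "Linf_on \<Omega> a" and f: "L2_on \<Omega> f"
  shows "L2_on \<Omega> (\<lambda>x. a x *\<^sub>R f x)"
proof -
  obtain C where C: "AE x in lebesgue_on \<Omega>. \<bar>a x\<bar> \<le> C" using a by (auto simp: Linf_on_def)
  have "integrable (lebesgue_on \<Omega>) (\<lambda>x. (norm (a x *\<^sub>R f x))\<^sup>2)"
  proof (rule Bochner_Integration.integrable_bound)
    show "integrable (lebesgue_on \<Omega>) (\<lambda>x. C\<^sup>2 * (norm (f x))\<^sup>2)"
      using f by (auto simp: L2_on_def)
    show "AE x in lebesgue_on \<Omega>. norm ((norm (a x *\<^sub>R f x))\<^sup>2) \<le> norm (C\<^sup>2 * (norm (f x))\<^sup>2)"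
      using C by eventually_elim (auto simp: power_mult_distrib intro!: mult_right_mono abs_le_square_iff[THEN iffD1])
  qed (use a f in \<open>auto simp: L2_on_def Linf_on_def\<close>)
  then show ?thesis using a f by (auto simp: L2_on_def Linf_on_def)
qed

lemma L2_on_scaleR:
  fixes f :: "'a::euclidean_space \<Rightarrow> 'b::euclidean_space"
  shows "L2_on \<Omega> f \<Longrightarrow> L2_on \<Omega> (\<lambda>x. c *\<^sub>R f x)"
  by (rule L2_on_scaleR_Linf[OF Linf_on_const])

lemma L2_on_add:
  fixes f g :: "'a::euclidean_space \<Rightarrow> 'b::euclidean_space"
  assumes f: "L2_on \<Omega> f" and g: "L2_on \<Omega> g"
  shows "L2_on \<Omega> (\<lambda>x. f x + g x)"
proof -
  have "integrable (lebesgue_on \<Omega>) (\<lambda>x. (norm (f x))\<^sup>2 + 2 * (f x \<bullet> g x) + (norm (g x))\<^sup>2)"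
    using f g L2_on_integrable_inner[OF f g] by (auto simp: L2_on_def)
  also have "(\<lambda>x. (norm (f x))\<^sup>2 + 2 * (f x \<bullet> g x) + (norm (g x))\<^sup>2) = (\<lambda>x. (norm (f x + g x))\<^sup>2)"
    by (auto simp: power2_norm_eq_inner algebra_simps inner_commute)
  finally show ?thesis using f g by (auto simp: L2_on_def)
qed

lemma L2_on_diff:
  fixes f g :: "'a::euclidean_space \<Rightarrow> 'b::euclidean_space"
  assumes f: "L2_on \<Omega> f" and g: "L2_on \<Omega> g"
  shows "L2_on \<Omega> (\<lambda>x. f x - g x)"
  using L2_on_add[OF f L2_on_scaleR[OF g, of "-1"]] by simp

lemma L2_on_zero: "L2_on \<Omega> (\<lambda>x. 0::'b::euclidean_space)"
  by (auto simp: L2_on_def)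

section \<open>Weighted bilinear forms on L^2: algebra and Cauchy-Schwarz\<close>

lemma weighted_inner_integrable:
  fixes f g :: "'a::euclidean_space \<Rightarrow> 'b::euclidean_space"
  assumes "Linf_on \<Omega> a" "L2_on \<Omega> f" "L2_on \<Omega> g"
  shows "integrable (lebesgue_on \<Omega>) (\<lambda>x. a x * (f x \<bullet> g x))"
  using L2_on_integrable_inner[OF L2_on_scaleR_Linf[OF assms(1,2)] assms(3)] by simp

lemma weighted_inner_commute: "weighted_inner \<Omega> a f g = weighted_inner \<Omega> a g f"
  by (simp add: weighted_inner_def inner_commute)

lemma weighted_inner_add_left:
  assumes "Linf_on \<Omega> a" "L2_on \<Omega> f" "L2_on \<Omega> g" "L2_on \<Omega> h"
  shows "weighted_inner \<Omega> a (\<lambda>x. f x + g x) h = weighted_inner \<Omega> a f h + weighted_inner \<Omega> a g h"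
  unfolding weighted_inner_def
  by (subst Bochner_Integration.integral_add[symmetric])
     (auto simp: algebra_simps assms intro!: weighted_inner_integrable)

lemma weighted_inner_diff_left:
  assumes "Linf_on \<Omega> a" "L2_on \<Omega> f" "L2_on \<Omega> g" "L2_on \<Omega> h"
  shows "weighted_inner \<Omega> a (\<lambda>x. f x - g x) h = weighted_inner \<Omega> a f h - weighted_inner \<Omega> a g h"
  unfolding weighted_inner_def
  by (subst Bochner_Integration.integral_diff[symmetric])
     (auto simp: algebra_simps assms intro!: weighted_inner_integrable)

lemma weighted_inner_scaleR_left: "weighted_inner \<Omega> a (\<lambda>x. c *\<^sub>R f x) h = c * weighted_inner \<Omega> a f h"
  by (simp add: weighted_inner_def mult.left_commute)

lemma weighted_inner_add_right:
  assumes "Linf_on \<Omega> a" "L2_on \<Omega> f" "L2_on \<Omega> g" "L2_on \<Omega> h"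
  shows "weighted_inner \<Omega> a h (\<lambda>x. f x + g x) = weighted_inner \<Omega> a h f + weighted_inner \<Omega> a h g"
  using weighted_inner_add_left[OF assms] by (simp add: weighted_inner_commute)

lemma weighted_inner_diff_right:
  assumes "Linf_on \<Omega> a" "L2_on \<Omega> f" "L2_on \<Omega> g" "L2_on \<Omega> h"
  shows "weighted_inner \<Omega> a h (\<lambda>x. f x - g x) = weighted_inner \<Omega> a h f - weighted_inner \<Omega> a h g"
  using weighted_inner_diff_left[OF assms] by (simp add: weighted_inner_commute)

lemma weighted_inner_scaleR_right: "weighted_inner \<Omega> a h (\<lambda>x. c *\<^sub>R f x) = c * weighted_inner \<Omega> a h f"
  by (simp add: weighted_inner_def mult.left_commute)

lemma weighted_inner_cong_AE:
  assumes "Linf_on \<Omega> a" "L2_on \<Omega> f" "L2_on \<Omega> f'" "L2_on \<Omega> g" "L2_on \<Omega> g'"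
    and "AE x in lebesgue_on \<Omega>. f x = f' x" and "AE x in lebesgue_on \<Omega>. g x = g' x"
  shows "weighted_inner \<Omega> a f g = weighted_inner \<Omega> a f' g'"
  unfolding weighted_inner_def
  by (rule integral_cong_AE) (use assms in \<open>auto simp: L2_on_def Linf_on_def\<close>)

lemma weighted_inner_nonneg:
  assumes "AE x in lebesgue_on \<Omega>. 0 \<le> a x"
  shows "0 \<le> weighted_inner \<Omega> a f f"
  unfolding weighted_inner_def by (rule integral_nonneg_AE) (use assms in \<open>auto elim!: eventually_mono\<close>)

lemma weighted_inner_one_eq: "weighted_inner \<Omega> (\<lambda>x. 1) f f = integral\<^sup>L (lebesgue_on \<Omega>) (\<lambda>x. (norm (f x))\<^sup>2)"
  by (simp add: weighted_inner_def power2_norm_eq_inner)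

lemma weighted_inner_add_self:
  assumes "Linf_on \<Omega> a" "L2_on \<Omega> f" "L2_on \<Omega> g"
  shows "weighted_inner \<Omega> a (\<lambda>x. f x + g x) (\<lambda>x. f x + g x) = weighted_inner \<Omega> a f f + 2 * weighted_inner \<Omega> a f g + weighted_inner \<Omega> a g g"
  by (simp add: weighted_inner_add_left weighted_inner_add_right assms L2_on_add weighted_inner_commute[of _ _ g f])

lemma weighted_inner_diff_self:
  assumes "Linf_on \<Omega> a" "L2_on \<Omega> f" "L2_on \<Omega> g"
  shows "weighted_inner \<Omega> a (\<lambda>x. f x - g x) (\<lambda>x. f x - g x) = weighted_inner \<Omega> a f f - 2 * weighted_inner \<Omega> a f g + weighted_inner \<Omega> a g g"
  by (simp add: weighted_inner_diff_left weighted_inner_diff_right assms L2_on_diff weighted_inner_commute[of _ _ g f])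

text \<open>The form at \<open>f + t g\<close> is a nonnegative quadratic polynomial in
  \<open>t\<close>. The weight may vanish on a set of positive measure, so a zero leading
  coefficient has to be treated separately.\<close>

lemma weighted_inner_Cauchy_Schwarz:
  assumes a: "Linf_on \<Omega> a" "AE x in lebesgue_on \<Omega>. 0 \<le> a x" and f: "L2_on \<Omega> f" and g: "L2_on \<Omega> g"
  shows "(weighted_inner \<Omega> a f g)\<^sup>2 \<le> weighted_inner \<Omega> a f f * weighted_inner \<Omega> a g g"
proof -
  have "0 \<le> weighted_inner \<Omega> a f f + 2 * t * weighted_inner \<Omega> a f g + t\<^sup>2 * weighted_inner \<Omega> a g g" for t
    using weighted_inner_nonneg[OF a(2), of "\<lambda>x. f x + t *\<^sub>R g x"] weighted_inner_add_self[OF a(1) f L2_on_scaleR[OF g, of t]]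
    by (simp add: weighted_inner_scaleR_left weighted_inner_scaleR_right power2_eq_square mult.assoc)
  note * = this
  show ?thesis
  proof (cases "weighted_inner \<Omega> a g g = 0")
    case True
    have "weighted_inner \<Omega> a f g = 0"
    proof (rule ccontr)
      assume n: "weighted_inner \<Omega> a f g \<noteq> 0"
      \<comment> \<open>The polynomial is now affine in \<open>t\<close>, and this \<open>t\<close>
        gives it the value -1.\<close>
      show False using *[of "- (weighted_inner \<Omega> a f f + 1) / (2 * weighted_inner \<Omega> a f g)"] True n weighted_inner_nonneg[OF a(2), of f]
        by (simp add: field_simps)
    qed
    then show ?thesis using True by simp
  next
    case False
    then have p: "weighted_inner \<Omega> a g g > 0" using weighted_inner_nonneg[OF a(2), of g] by simp
    \<comment> \<open>The minimiser of the quadratic polynomial.\<close>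
    show ?thesis using *[of "- weighted_inner \<Omega> a f g / weighted_inner \<Omega> a g g"] p
      by (simp add: field_simps power2_eq_square)
  qed
qed

section \<open>Passing to L^2 limits in weighted forms\<close>

lemma weighted_inner_one_tendsto_zero:
  assumes f: "\<And>k. L2_on \<Omega> (f k)" and g: "L2_on \<Omega> g"
    and lim: "(\<lambda>k. integral\<^sup>L (lebesgue_on \<Omega>) (\<lambda>x. (norm (f k x))\<^sup>2)) \<longlonglongrightarrow> 0"
  shows "(\<lambda>k. weighted_inner \<Omega> (\<lambda>x. 1) (f k) g) \<longlonglongrightarrow> 0"
proof -
  have "(\<lambda>k. (weighted_inner \<Omega> (\<lambda>x. 1) (f k) g)\<^sup>2) \<longlonglongrightarrow> 0"
  proof (rule tendsto_sandwich[OF _ _ tendsto_const])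
    show "(\<lambda>k. integral\<^sup>L (lebesgue_on \<Omega>) (\<lambda>x. (norm (f k x))\<^sup>2) * weighted_inner \<Omega> (\<lambda>x. 1) g g) \<longlonglongrightarrow> 0"
      using tendsto_mult_left_zero[OF lim] by simp
    show "\<forall>\<^sub>F k in sequentially. (weighted_inner \<Omega> (\<lambda>x. 1) (f k) g)\<^sup>2
        \<le> integral\<^sup>L (lebesgue_on \<Omega>) (\<lambda>x. (norm (f k x))\<^sup>2) * weighted_inner \<Omega> (\<lambda>x. 1) g g"
      using weighted_inner_Cauchy_Schwarz[OF Linf_on_const[of \<Omega> 1] _ f g] by (simp add: weighted_inner_one_eq)
  qed auto
  then show ?thesis by simp
qed

text \<open>The bounded weight is moved onto \<open>g\<close>, which stays square-integrable. Only
  the unweighted Cauchy-Schwarz inequality is then used, so \<open>a\<close> may change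
  sign.\<close>

lemma weighted_inner_tendsto:
  assumes a: "Linf_on \<Omega> a" and f: "\<And>k. L2_on \<Omega> (f k)" "L2_on \<Omega> F" and g: "L2_on \<Omega> g"
    and lim: "(\<lambda>k. integral\<^sup>L (lebesgue_on \<Omega>) (\<lambda>x. (norm (F x - f k x))\<^sup>2)) \<longlonglongrightarrow> 0"
  shows "(\<lambda>k. weighted_inner \<Omega> a (f k) g) \<longlonglongrightarrow> weighted_inner \<Omega> a F g"
proof -
  have "(\<lambda>k. weighted_inner \<Omega> (\<lambda>x. 1) (\<lambda>x. F x - f k x) (\<lambda>x. a x *\<^sub>R g x)) \<longlonglongrightarrow> 0"
    by (intro weighted_inner_one_tendsto_zero lim L2_on_diff f L2_on_scaleR_Linf a g)
  also have "(\<lambda>k. weighted_inner \<Omega> (\<lambda>x. 1) (\<lambda>x. F x - f k x) (\<lambda>x. a x *\<^sub>R g x)) = (\<lambda>k. weighted_inner \<Omega> a F g - weighted_inner \<Omega> a (f k) g)"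
    using weighted_inner_diff_left[OF a f(2) f(1) g] by (simp add: weighted_inner_def)
  finally show ?thesis using tendsto_diff[OF tendsto_const[of "weighted_inner \<Omega> a F g"]] by fastforce
qed


lemma weighted_inner_self_tendsto:
  assumes a: "Linf_on \<Omega> a" and f: "\<And>k. L2_on \<Omega> (f k)" "L2_on \<Omega> F"
    and lim: "(\<lambda>k. integral\<^sup>L (lebesgue_on \<Omega>) (\<lambda>x. (norm (F x - f k x))\<^sup>2)) \<longlonglongrightarrow> 0"
  shows "(\<lambda>k. weighted_inner \<Omega> a (f k) (f k)) \<longlonglongrightarrow> weighted_inner \<Omega> a F F"
proof -
  obtain C where C: "AE x in lebesgue_on \<Omega>. \<bar>a x\<bar> \<le> C" using a by (auto simp: Linf_on_def)
  let ?e = "\<lambda>k x. F x - f k x"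
  have e: "L2_on \<Omega> (?e k)" for k by (intro L2_on_diff f)
  have "(\<lambda>k. weighted_inner \<Omega> a (?e k) (?e k)) \<longlonglongrightarrow> 0"
  proof (rule Lim_null_comparison)
    show "(\<lambda>k. C * integral\<^sup>L (lebesgue_on \<Omega>) (\<lambda>x. (norm (?e k x))\<^sup>2)) \<longlonglongrightarrow> 0"
      using tendsto_mult_right_zero[OF lim] by simp
    have "norm (weighted_inner \<Omega> a (?e k) (?e k)) \<le> C * integral\<^sup>L (lebesgue_on \<Omega>) (\<lambda>x. (norm (?e k x))\<^sup>2)" for k
    proof -
      have i: "integrable (lebesgue_on \<Omega>) (\<lambda>x. C * (norm (?e k x))\<^sup>2)"
        using e[of k] by (auto simp: L2_on_def)
      have "norm (weighted_inner \<Omega> a (?e k) (?e k)) \<le> integral\<^sup>L (lebesgue_on \<Omega>) (\<lambda>x. norm (a x * (?e k x \<bullet> ?e k x)))"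
        unfolding weighted_inner_def by (rule integral_norm_bound)
      also have "\<dots> \<le> integral\<^sup>L (lebesgue_on \<Omega>) (\<lambda>x. C * (norm (?e k x))\<^sup>2)"
        by (rule integral_mono_AE[OF integrable_norm[OF weighted_inner_integrable[OF a e e]] i])
           (use C in \<open>auto simp: abs_mult power2_norm_eq_inner intro: mult_right_mono elim!: eventually_mono\<close>)
      finally show ?thesis by simp
    qed
    then show "\<forall>\<^sub>F k in sequentially. norm (weighted_inner \<Omega> a (?e k) (?e k)) \<le> C * integral\<^sup>L (lebesgue_on \<Omega>) (\<lambda>x. (norm (?e k x))\<^sup>2)"
      by simp
  qed
  \<comment> \<open>Expanding the form at \<open>F - f k\<close> and solving for the term at
    \<open>f k\<close> leaves an error term that tends to 0 and a term linear in \<open>f k\<close>,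
    to which the preceding convergence result applies.\<close>
  moreover have "weighted_inner \<Omega> a (f k) (f k) = weighted_inner \<Omega> a (?e k) (?e k) - weighted_inner \<Omega> a F F + 2 * weighted_inner \<Omega> a (f k) F" for k
    using weighted_inner_diff_self[OF a f(2) f(1)[of k]] by (simp add: weighted_inner_commute[of \<Omega> a F "f k"])
  ultimately show ?thesis
    using tendsto_add[OF tendsto_diff[OF \<open>(\<lambda>k. weighted_inner \<Omega> a (?e k) (?e k)) \<longlonglongrightarrow> 0\<close> tendsto_const[of "weighted_inner \<Omega> a F F"]]
        tendsto_mult[OF tendsto_const[of 2] weighted_inner_tendsto[OF a f f(2) lim]]]
    by simp
qed

lemma weighted_inner_lower_bound:
  assumes a: "Linf_on \<Omega> a" "AE x in lebesgue_on \<Omega>. lo \<le> a x" and f: "L2_on \<Omega> f"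
  shows "lo * integral\<^sup>L (lebesgue_on \<Omega>) (\<lambda>x. (norm (f x))\<^sup>2) \<le> weighted_inner \<Omega> a f f"
proof -
  have "integral\<^sup>L (lebesgue_on \<Omega>) (\<lambda>x. lo * (norm (f x))\<^sup>2) \<le> weighted_inner \<Omega> a f f"
    unfolding weighted_inner_def
  proof (rule integral_mono_AE)
    show "AE x in lebesgue_on \<Omega>. lo * (norm (f x))\<^sup>2 \<le> a x * (f x \<bullet> f x)"
      using a(2) by eventually_elim (simp add: power2_norm_eq_inner mult_right_mono)
  qed (use f weighted_inner_integrable[OF a(1) f f] in \<open>auto simp: L2_on_def\<close>)
  then show ?thesis by simp
qed

lemma weighted_inner_diff_weight:
  assumes "Linf_on \<Omega> a" "Linf_on \<Omega> b" "L2_on \<Omega> f" "L2_on \<Omega> g"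
  shows "weighted_inner \<Omega> (\<lambda>x. a x - b x) f g = weighted_inner \<Omega> a f g - weighted_inner \<Omega> b f g"
  unfolding weighted_inner_def
  by (subst Bochner_Integration.integral_diff[symmetric])
     (auto simp: algebra_simps assms intro!: weighted_inner_integrable)

text \<open>Translates plain L^2 products of the scaled gradients in (i) into the weights that occur
  in \<open>DN\<close> and \<open>DNd\<close>.\<close>

lemma weighted_inner_scaleR_weights:
  "weighted_inner \<Omega> (\<lambda>x. 1) (\<lambda>x. b x *\<^sub>R f x) (\<lambda>x. c x *\<^sub>R g x) = weighted_inner \<Omega> (\<lambda>x. b x * c x) f g"
  by (simp add: weighted_inner_def mult.assoc mult.left_commute)

lemma weighted_inner_cong_weight:
  assumes "a \<in> borel_measurable (lebesgue_on \<Omega>)" "b \<in> borel_measurable (lebesgue_on \<Omega>)" "L2_on \<Omega> f" "L2_on \<Omega> g"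
    and "AE x in lebesgue_on \<Omega>. a x = b x"
  shows "weighted_inner \<Omega> a f g = weighted_inner \<Omega> b f g"
  unfolding weighted_inner_def by (rule integral_cong_AE) (use assms in \<open>auto simp: L2_on_def\<close>)

lemma L2_on_bounded_linear:
  fixes f :: "'a::euclidean_space \<Rightarrow> 'b::euclidean_space" and T :: "'b \<Rightarrow> 'c::euclidean_space"
  assumes T: "bounded_linear T" and f: "L2_on \<Omega> f"
  shows "L2_on \<Omega> (\<lambda>x. T (f x))"
proof -
  obtain K where K: "\<And>x. norm (T x) \<le> norm x * K" using bounded_linear.bounded[OF T] by blast
  have [measurable]: "f \<in> borel_measurable (lebesgue_on \<Omega>)" using f by (rule L2_on_measurable)
  have [measurable]: "T \<in> borel_measurable borel"
    by (intro borel_measurable_continuous_onI linear_continuous_on T)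
  have "integrable (lebesgue_on \<Omega>) (\<lambda>x. (norm (T (f x)))\<^sup>2)"
  proof (rule Bochner_Integration.integrable_bound)
    show "integrable (lebesgue_on \<Omega>) (\<lambda>x. K\<^sup>2 * (norm (f x))\<^sup>2)" using f by (auto simp: L2_on_def)
    have "(norm (T y))\<^sup>2 \<le> K\<^sup>2 * (norm y)\<^sup>2" for y
      using power_mono[OF K[of y], of 2] by (simp add: power_mult_distrib mult.commute)
    then show "AE x in lebesgue_on \<Omega>. norm ((norm (T (f x)))\<^sup>2) \<le> norm (K\<^sup>2 * (norm (f x))\<^sup>2)"
      by (auto intro!: AE_I2)
  qed measurable
  then show ?thesis by (simp add: L2_on_def)
qed

lemma L2_norm_diff_tendsto:
  fixes u v :: "'a::euclidean_space \<Rightarrow> 'b::euclidean_space"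
  assumes L: "L2_on \<Omega> u" "L2_on \<Omega> v" "\<And>k. L2_on \<Omega> (f k)" "\<And>k. L2_on \<Omega> (g k)"
    and lu: "(\<lambda>k. integral\<^sup>L (lebesgue_on \<Omega>) (\<lambda>x. (norm (u x - f k x))\<^sup>2)) \<longlonglongrightarrow> 0"
    and lv: "(\<lambda>k. integral\<^sup>L (lebesgue_on \<Omega>) (\<lambda>x. (norm (v x - g k x))\<^sup>2)) \<longlonglongrightarrow> 0"
  shows "(\<lambda>k. integral\<^sup>L (lebesgue_on \<Omega>) (\<lambda>x. (norm ((u x - v x) - (f k x - g k x)))\<^sup>2)) \<longlonglongrightarrow> 0"
proof (rule tendsto_sandwich[OF _ _ tendsto_const])
  let ?M = "lebesgue_on \<Omega>"
  show "(\<lambda>k. 2 * integral\<^sup>L ?M (\<lambda>x. (norm (u x - f k x))\<^sup>2) + 2 * integral\<^sup>L ?M (\<lambda>x. (norm (v x - g k x))\<^sup>2)) \<longlonglongrightarrow> 0"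
    using tendsto_add[OF tendsto_mult[OF tendsto_const[of 2] lu] tendsto_mult[OF tendsto_const[of 2] lv]] by simp
  have "integral\<^sup>L ?M (\<lambda>x. (norm ((u x - v x) - (f k x - g k x)))\<^sup>2)
      \<le> 2 * integral\<^sup>L ?M (\<lambda>x. (norm (u x - f k x))\<^sup>2) + 2 * integral\<^sup>L ?M (\<lambda>x. (norm (v x - g k x))\<^sup>2)" for k
  proof -
    have i: "integrable ?M (\<lambda>x. (norm (u x - f k x))\<^sup>2)" "integrable ?M (\<lambda>x. (norm (v x - g k x))\<^sup>2)"
      "integrable ?M (\<lambda>x. (norm ((u x - v x) - (f k x - g k x)))\<^sup>2)"
      using L2_on_diff[OF L(1,3)] L2_on_diff[OF L(2,4)] L2_on_diff[OF L2_on_diff[OF L(1,2)] L2_on_diff[OF L(3,4)]]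
      by (auto simp: L2_on_def)
    \<comment> \<open>A consequence of the parallelogram identity that replaces Minkowski's
      inequality and keeps all integrals free of square roots.\<close>
    have p: "(norm (a - b))\<^sup>2 \<le> 2 * (norm a)\<^sup>2 + 2 * (norm b)\<^sup>2" for a b :: 'b
    proof -
      have "0 \<le> (norm (a + b))\<^sup>2" by simp
      then show ?thesis unfolding power2_norm_eq_inner by (simp add: algebra_simps inner_commute)
    qed
    have "integral\<^sup>L ?M (\<lambda>x. (norm ((u x - v x) - (f k x - g k x)))\<^sup>2)
        \<le> integral\<^sup>L ?M (\<lambda>x. 2 * (norm (u x - f k x))\<^sup>2 + 2 * (norm (v x - g k x))\<^sup>2)"
    proof (rule integral_mono)
      show "(norm ((u x - v x) - (f k x - g k x)))\<^sup>2 \<le> 2 * (norm (u x - f k x))\<^sup>2 + 2 * (norm (v x - g k x))\<^sup>2" for x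
        using p[of "u x - f k x" "v x - g k x"] by (simp add: algebra_simps)
    qed (use i in auto)
    then show ?thesis using i by simp
  qed
  then show "\<forall>\<^sub>F k in sequentially. integral\<^sup>L ?M (\<lambda>x. (norm ((u x - v x) - (f k x - g k x)))\<^sup>2)
      \<le> 2 * integral\<^sup>L ?M (\<lambda>x. (norm (u x - f k x))\<^sup>2) + 2 * integral\<^sup>L ?M (\<lambda>x. (norm (v x - g k x))\<^sup>2)"
    by (intro always_eventually allI)
qed simp

section \<open>Completeness of L^2 on a set of finite measure\<close>

lemma L2_on_const:
  assumes "\<Omega> \<in> lmeasurable"
  shows "L2_on \<Omega> (\<lambda>x. c::'b::euclidean_space)"
proof -
  interpret finite_measure "lebesgue_on \<Omega>" by (rule finite_measure_lebesgue_on[OF assms])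
  show ?thesis by (simp add: L2_on_def)
qed

lemma L2_on_integrable:
  fixes f :: "'a::euclidean_space \<Rightarrow> 'b::euclidean_space"
  assumes "\<Omega> \<in> lmeasurable" "L2_on \<Omega> f"
  shows "integrable (lebesgue_on \<Omega>) f"
  using L2_on_integrable_scaleR[OF L2_on_const[OF assms(1), of 1] assms(2)] by simp

lemma L2_on_norm:
  fixes f :: "'a::euclidean_space \<Rightarrow> 'b::euclidean_space"
  shows "L2_on \<Omega> f \<Longrightarrow> L2_on \<Omega> (\<lambda>x. norm (f x))"
  by (auto simp: L2_on_def)

text \<open>Riesz-Fischer by way of L^1: finite measure makes the sequence Cauchy in L^1, which
  yields a subsequence that is Cauchy almost everywhere. Fatou's lemma then turns the L^2 Cauchy
  estimate into convergence of the full sequence to the pointwise limit.\<close>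

lemma L2_on_complete:
  fixes f :: "nat \<Rightarrow> 'a::euclidean_space \<Rightarrow> 'b::euclidean_space"
  assumes \<Omega>: "\<Omega> \<in> lmeasurable" and f: "\<And>k. L2_on \<Omega> (f k)"
    and Cauchy: "\<And>e. e > 0 \<Longrightarrow> \<exists>N. \<forall>m\<ge>N. \<forall>n\<ge>N. integral\<^sup>L (lebesgue_on \<Omega>) (\<lambda>x. (norm (f m x - f n x))\<^sup>2) < e"
  obtains F where "L2_on \<Omega> F" "(\<lambda>k. integral\<^sup>L (lebesgue_on \<Omega>) (\<lambda>x. (norm (F x - f k x))\<^sup>2)) \<longlonglongrightarrow> 0"
proof -
  let ?M = "lebesgue_on \<Omega>"
  let ?\<mu> = "measure ?M (space ?M)"
  interpret finite_measure ?M by (rule finite_measure_lebesgue_on[OF \<Omega>])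
  have [measurable]: "f k \<in> borel_measurable ?M" for k using f by (rule L2_on_measurable)
  have L1: "\<exists>N. \<forall>m\<ge>N. \<forall>n\<ge>N. integral\<^sup>L ?M (\<lambda>x. norm (f m x - f n x)) < e" if e: "e > 0" for e
  proof -
    have p: "?\<mu> \<ge> 0" by simp
    have less: "e\<^sup>2 / (m + 1) * m < e\<^sup>2" if "m \<ge> 0" for m :: real
    proof -
      have "e\<^sup>2 * m < e\<^sup>2 * (m + 1)" using e by (simp add: algebra_simps)
      then show ?thesis using that by (simp add: pos_divide_less_eq)
    qed
    \<comment> \<open>The \<open>+ 1\<close> covers a set of measure zero and leaves strict room
      after multiplication by the measure.\<close>
    obtain N where N: "\<And>m n. m \<ge> N \<Longrightarrow> n \<ge> N \<Longrightarrow> integral\<^sup>L ?M (\<lambda>x. (norm (f m x - f n x))\<^sup>2) < e\<^sup>2 / (?\<mu> + 1)"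
      using Cauchy[of "e\<^sup>2 / (?\<mu> + 1)"] e p by (auto simp: add_nonneg_pos)
    have "integral\<^sup>L ?M (\<lambda>x. norm (f m x - f n x)) < e" if "m \<ge> N" "n \<ge> N" for m n
    proof (rule power2_less_imp_less)
      \<comment> \<open>Cauchy-Schwarz against the constant function 1.\<close>
      have "(integral\<^sup>L ?M (\<lambda>x. norm (f m x - f n x)))\<^sup>2 \<le> integral\<^sup>L ?M (\<lambda>x. (norm (f m x - f n x))\<^sup>2) * ?\<mu>"
        using weighted_inner_Cauchy_Schwarz[OF Linf_on_const[of \<Omega> 1] _ L2_on_norm[OF L2_on_diff[OF f[of m] f[of n]]] L2_on_const[OF \<Omega>, of "1::real"]]
        by (simp add: weighted_inner_def power2_eq_square)
      also have "\<dots> \<le> e\<^sup>2 / (?\<mu> + 1) * ?\<mu>"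
        using N[OF that] by (intro mult_right_mono) auto
      also have "\<dots> < e\<^sup>2" using p by (rule less)
      finally show "(integral\<^sup>L ?M (\<lambda>x. norm (f m x - f n x)))\<^sup>2 < e\<^sup>2" .
    qed (use e in auto)
    then show ?thesis by blast
  qed
  obtain r where r: "strict_mono r" and AEC: "AE x in ?M. Cauchy (\<lambda>i. f (r i) x)"
    using cauchy_L1_AE_cauchy_subseq[of ?M f] L2_on_integrable[OF \<Omega> f] L1 by blast
  define F where "F x = lim (\<lambda>i. f (r i) x)" for x
  have [measurable]: "F \<in> borel_measurable ?M"
    unfolding F_def by measurable
  have AEF: "AE x in ?M. (\<lambda>i. f (r i) x) \<longlonglongrightarrow> F x"
    using AEC by eventually_elim (simp add: F_def Cauchy_convergent_iff convergent_LIMSEQ_iff)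
  \<comment> \<open>Fatou with \<open>n\<close> fixed while the other index runs through the
    subsequence. It is phrased with the nonnegative integral because integrability of the limit is
    only deduced from it.\<close>
  have nn: "(\<integral>\<^sup>+ x. ennreal ((norm (F x - f n x))\<^sup>2) \<partial>?M) \<le> ennreal e"
    if N: "\<And>m. m \<ge> N \<Longrightarrow> integral\<^sup>L ?M (\<lambda>x. (norm (f m x - f n x))\<^sup>2) < e" for n N e
  proof -
    have "(\<integral>\<^sup>+ x. ennreal ((norm (F x - f n x))\<^sup>2) \<partial>?M)
        = (\<integral>\<^sup>+ x. liminf (\<lambda>i. ennreal ((norm (f (r i) x - f n x))\<^sup>2)) \<partial>?M)"
    proof (rule nn_integral_cong_AE)
      show "AE x in ?M. ennreal ((norm (F x - f n x))\<^sup>2) = liminf (\<lambda>i. ennreal ((norm (f (r i) x - f n x))\<^sup>2))"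
        using AEF
      proof eventually_elim
        case (elim x)
        have "(\<lambda>i. ennreal ((norm (f (r i) x - f n x))\<^sup>2)) \<longlonglongrightarrow> ennreal ((norm (F x - f n x))\<^sup>2)"
          by (intro tendsto_intros elim)
        then show ?case using lim_imp_Liminf[of sequentially] by fastforce
      qed
    qed
    also have "\<dots> \<le> liminf (\<lambda>i. \<integral>\<^sup>+ x. ennreal ((norm (f (r i) x - f n x))\<^sup>2) \<partial>?M)"
      by (rule nn_integral_liminf) measurable
    also have "\<dots> \<le> ennreal e"
    proof (rule Liminf_le)
      show "\<forall>\<^sub>F i in sequentially. (\<integral>\<^sup>+ x. ennreal ((norm (f (r i) x - f n x))\<^sup>2) \<partial>?M) \<le> ennreal e"
        using eventually_ge_at_top[of N]
      proof eventually_elim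
        case (elim i)
        then have "r i \<ge> N" using seq_suble[OF r, of i] by simp
        have "(\<integral>\<^sup>+ x. ennreal ((norm (f (r i) x - f n x))\<^sup>2) \<partial>?M)
            = ennreal (integral\<^sup>L ?M (\<lambda>x. (norm (f (r i) x - f n x))\<^sup>2))"
          using L2_on_diff[OF f[of "r i"] f[of n]] by (intro nn_integral_eq_integral) (auto simp: L2_on_def)
        then show ?case using N[OF \<open>r i \<ge> N\<close>] by (simp add: ennreal_leI)
      qed
    qed simp
    finally show ?thesis .
  qed
  have int: "integrable ?M (\<lambda>x. (norm (F x - f n x))\<^sup>2)"
    if N: "\<And>m. m \<ge> N \<Longrightarrow> integral\<^sup>L ?M (\<lambda>x. (norm (f m x - f n x))\<^sup>2) < e" for n N e
    using le_less_trans[OF nn[OF N] ennreal_less_top] by (intro integrableI_bounded) auto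
  have LF: "L2_on \<Omega> F"
  proof -
    obtain N where N: "\<And>m n. m \<ge> N \<Longrightarrow> n \<ge> N \<Longrightarrow> integral\<^sup>L ?M (\<lambda>x. (norm (f m x - f n x))\<^sup>2) < 1"
      using Cauchy[of 1] by auto
    have "L2_on \<Omega> (\<lambda>x. F x - f N x)" using int[of N N 1] N by (auto simp: L2_on_def)
    from L2_on_add[OF this f[of N]] show ?thesis by simp
  qed
  have "(\<lambda>k. integral\<^sup>L ?M (\<lambda>x. (norm (F x - f k x))\<^sup>2)) \<longlonglongrightarrow> 0"
  proof (rule LIMSEQ_I)
    fix e :: real assume e: "e > 0"
    obtain N where N: "\<And>m n. m \<ge> N \<Longrightarrow> n \<ge> N \<Longrightarrow> integral\<^sup>L ?M (\<lambda>x. (norm (f m x - f n x))\<^sup>2) < e / 2"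
      using Cauchy[of "e/2"] e by auto
    have "norm (integral\<^sup>L ?M (\<lambda>x. (norm (F x - f n x))\<^sup>2) - 0) < e" if n: "n \<ge> N" for n
    proof -
      have "ennreal (integral\<^sup>L ?M (\<lambda>x. (norm (F x - f n x))\<^sup>2)) = (\<integral>\<^sup>+ x. ennreal ((norm (F x - f n x))\<^sup>2) \<partial>?M)"
        using int[of N n "e/2"] N n by (intro nn_integral_eq_integral[symmetric]) auto
      also have "\<dots> \<le> ennreal (e/2)" using nn[of N n "e/2"] N n by auto
      finally have "integral\<^sup>L ?M (\<lambda>x. (norm (F x - f n x))\<^sup>2) \<le> e / 2" using e by (simp add: ennreal_le_iff)
      then show ?thesis using e by simp
    qed
    then show "\<exists>N. \<forall>n\<ge>N. norm (integral\<^sup>L ?M (\<lambda>x. (norm (F x - f n x))\<^sup>2) - 0) < e" by blast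
  qed
  with LF that show ?thesis by blast
qed

section \<open>Test functions\<close>

lemma compact_closed_subset:
  fixes K :: "'a::t2_space set"
  assumes "compact K" "closed S" "S \<subseteq> K" shows "compact S"
  using compact_Int_closed[OF assms(1,2)] assms(3) by (simp add: Int_absorb1)

lemma borel_measurable_lebesgue_on:
  "f \<in> borel_measurable borel \<Longrightarrow> f \<in> borel_measurable (lebesgue_on \<Omega>)"
  by (simp add: measurable_completion measurable_restrict_space1)

text \<open>The complement of the closed support is open, so \<phi> is zero near \<open>x\<close>,
  and uniqueness of the derivative forces the gradient to vanish there as well.\<close>

lemma test_fun_outside:
  assumes "test_fun \<Omega> \<phi> D" "x \<notin> closure {x. \<phi> x \<noteq> 0}"
  shows "\<phi> x = 0" "D x = 0"
proof -
  let ?K = "closure {x. \<phi> x \<noteq> 0}"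
  have z: "\<phi> y = 0" if "y \<notin> ?K" for y using that closure_subset[of "{x. \<phi> x \<noteq> 0}"] by blast
  then show "\<phi> x = 0" using assms(2) by blast
  have "(\<phi> has_derivative (\<lambda>h. 0)) (at x)"
  proof (rule has_derivative_transform_within_open)
    show "((\<lambda>x. 0) has_derivative (\<lambda>h. 0)) (at x)" by simp
    show "open (- ?K)" by (rule open_Compl) (rule closed_closure)
    show "x \<in> - ?K" using assms(2) by blast
    show "0 = \<phi> y" if "y \<in> - ?K" for y using z[of y] that by (metis ComplD)
  qed
  moreover have "(\<phi> has_derivative (\<lambda>h. D x \<bullet> h)) (at x)" using assms(1) by (simp add: test_fun_def)
  ultimately have "(\<lambda>h. D x \<bullet> h) = (\<lambda>h. 0)" by (rule has_derivative_unique[rotated])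
  then show "D x = 0" using inner_eq_zero_iff by metis
qed

lemma test_fun_outside_domain:
  assumes "test_fun \<Omega> \<phi> D" "x \<notin> \<Omega>"
  shows "\<phi> x = 0" "D x = 0"
proof -
  have "x \<notin> closure {x. \<phi> x \<noteq> 0}" using assms unfolding test_fun_def by blast
  then show "\<phi> x = 0" "D x = 0" by (rule test_fun_outside[OF assms(1)])+
qed

lemma test_fun_derivative: "test_fun \<Omega> \<phi> D \<Longrightarrow> (\<phi> has_derivative (\<lambda>h. D x \<bullet> h)) (at x)"
  by (simp add: test_fun_def)

lemma test_fun_continuous:
  assumes "test_fun \<Omega> \<phi> D"
  shows "continuous_on UNIV \<phi>" "continuous_on UNIV D"
proof -
  show "continuous_on UNIV \<phi>"
    by (rule has_derivative_continuous_on, rule has_derivative_at_withinI, rule test_fun_derivative[OF assms])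
qed (use assms in \<open>simp add: test_fun_def\<close>)

lemma test_fun_borel:
  assumes "test_fun \<Omega> \<phi> D"
  shows "\<phi> \<in> borel_measurable borel" "D \<in> borel_measurable borel"
  using test_fun_continuous[OF assms] by (auto intro: borel_measurable_continuous_onI)

lemma test_fun_bounded:
  assumes "test_fun \<Omega> \<phi> D"
  obtains C where "\<And>x. \<bar>\<phi> x\<bar> \<le> C" "\<And>x. norm (D x) \<le> C"
proof -
  let ?K = "closure {x. \<phi> x \<noteq> 0}"
  have K: "compact ?K" using assms by (simp add: test_fun_def)
  have "bounded (\<phi> ` ?K)" "bounded (D ` ?K)"
    using test_fun_continuous[OF assms] K
    by (auto intro!: compact_imp_bounded compact_continuous_image intro: continuous_on_subset)
  then obtain A B where A: "\<And>x. x \<in> ?K \<Longrightarrow> norm (\<phi> x) \<le> A" and B: "\<And>x. x \<in> ?K \<Longrightarrow> norm (D x) \<le> B"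
    by (metis bounded_iff imageI)
  have "\<bar>\<phi> x\<bar> \<le> \<bar>A\<bar> + \<bar>B\<bar>" "norm (D x) \<le> \<bar>A\<bar> + \<bar>B\<bar>" for x
  proof -
    have "\<bar>\<phi> x\<bar> \<le> \<bar>A\<bar> \<and> norm (D x) \<le> \<bar>B\<bar>"
    proof (cases "x \<in> ?K")
      case True
      then show ?thesis using A[OF True] B[OF True] by simp
    next
      case False
      then show ?thesis using test_fun_outside[OF assms False] by simp
    qed
    then show "\<bar>\<phi> x\<bar> \<le> \<bar>A\<bar> + \<bar>B\<bar>" "norm (D x) \<le> \<bar>A\<bar> + \<bar>B\<bar>" by linarith+
  qed
  then show ?thesis using that by blast
qed

lemma test_fun_L2:
  assumes "\<Omega> \<in> lmeasurable" "test_fun \<Omega> \<phi> D"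
  shows "L2_on \<Omega> \<phi>" "L2_on \<Omega> D"
proof -
  interpret finite_measure "lebesgue_on \<Omega>" by (rule finite_measure_lebesgue_on[OF assms(1)])
  obtain C where C: "\<And>x. \<bar>\<phi> x\<bar> \<le> C" "\<And>x. norm (D x) \<le> C" using test_fun_bounded[OF assms(2)] by blast
  have m: "\<phi> \<in> borel_measurable (lebesgue_on \<Omega>)" "D \<in> borel_measurable (lebesgue_on \<Omega>)"
    using test_fun_borel[OF assms(2)] by (auto intro: borel_measurable_lebesgue_on)
  have "integrable (lebesgue_on \<Omega>) (\<lambda>x. (norm (\<phi> x))\<^sup>2)"
    by (rule integrable_const_bound[of _ "C\<^sup>2"]) (use m C in \<open>auto intro!: power_mono abs_le_square_iff[THEN iffD1] simp: order_trans[OF C(1) abs_ge_self]\<close>)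
  moreover have "integrable (lebesgue_on \<Omega>) (\<lambda>x. (norm (D x))\<^sup>2)"
    by (rule integrable_const_bound[of _ "C\<^sup>2"]) (use m C in \<open>auto intro!: power_mono\<close>)
  ultimately show "L2_on \<Omega> \<phi>" "L2_on \<Omega> D" using m by (auto simp: L2_on_def)
qed

lemma test_fun_zero: "test_fun \<Omega> (\<lambda>x. 0) (\<lambda>x. 0)"
  by (simp add: test_fun_def)

text \<open>The factor \<open>g\<close> need not have compact support, so this one product rule
  covers constants, coordinate functions and other test functions.\<close>

lemma test_fun_mult_C1:
  assumes t: "test_fun \<Omega> \<phi> D" and g: "\<And>x. (g has_derivative (\<lambda>h. Dg x \<bullet> h)) (at x)" and c: "continuous_on UNIV Dg"
  shows "test_fun \<Omega> (\<lambda>x. g x * \<phi> x) (\<lambda>x. g x *\<^sub>R D x + \<phi> x *\<^sub>R Dg x)"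
  unfolding test_fun_def
proof (intro conjI allI)
  fix x
  show "((\<lambda>x. g x * \<phi> x) has_derivative (\<lambda>h. (g x *\<^sub>R D x + \<phi> x *\<^sub>R Dg x) \<bullet> h)) (at x)"
    by (rule has_derivative_eq_rhs[OF has_derivative_mult[OF g test_fun_derivative[OF t]]]) (auto simp: algebra_simps)
next
  have "continuous_on UNIV g" by (rule has_derivative_continuous_on, rule has_derivative_at_withinI, rule g)
  then show "continuous_on UNIV (\<lambda>x. g x *\<^sub>R D x + \<phi> x *\<^sub>R Dg x)"
    using test_fun_continuous[OF t] c by (intro continuous_intros) auto
  have s: "closure {x. g x * \<phi> x \<noteq> 0} \<subseteq> closure {x. \<phi> x \<noteq> 0}" by (rule closure_mono) auto
  show "compact (closure {x. g x * \<phi> x \<noteq> 0})"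
    by (rule compact_closed_subset[OF _ closed_closure s]) (use t in \<open>simp add: test_fun_def\<close>)
  show "closure {x. g x * \<phi> x \<noteq> 0} \<subseteq> \<Omega>"
    using s t unfolding test_fun_def by blast
qed

lemma test_fun_add:
  assumes t: "test_fun \<Omega> \<phi> D" and u: "test_fun \<Omega> \<psi> E"
  shows "test_fun \<Omega> (\<lambda>x. \<phi> x + \<psi> x) (\<lambda>x. D x + E x)"
  unfolding test_fun_def
proof (intro conjI allI)
  fix x
  show "((\<lambda>x. \<phi> x + \<psi> x) has_derivative (\<lambda>h. (D x + E x) \<bullet> h)) (at x)"
    by (rule has_derivative_eq_rhs[OF has_derivative_add[OF test_fun_derivative[OF t] test_fun_derivative[OF u]]]) (auto simp: algebra_simps)
next
  show "continuous_on UNIV (\<lambda>x. D x + E x)"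
    using test_fun_continuous[OF t] test_fun_continuous[OF u] by (intro continuous_intros) auto
  have s: "closure {x. \<phi> x + \<psi> x \<noteq> 0} \<subseteq> closure {x. \<phi> x \<noteq> 0} \<union> closure {x. \<psi> x \<noteq> 0}"
    unfolding closure_Un[symmetric] by (rule closure_mono) auto
  moreover have "compact (closure {x. \<phi> x \<noteq> 0} \<union> closure {x. \<psi> x \<noteq> 0})"
    using t u by (auto simp: test_fun_def)
  ultimately show "compact (closure {x. \<phi> x + \<psi> x \<noteq> 0})"
    by (intro compact_closed_subset[OF _ closed_closure])
  show "closure {x. \<phi> x + \<psi> x \<noteq> 0} \<subseteq> \<Omega>"
    using s t u unfolding test_fun_def by blast
qed

lemma test_fun_scale:
  assumes "test_fun \<Omega> \<phi> D"
  shows "test_fun \<Omega> (\<lambda>x. c * \<phi> x) (\<lambda>x. c *\<^sub>R D x)"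
  using test_fun_mult_C1[OF assms, of "\<lambda>x. c" "\<lambda>x. 0"] by simp

lemma test_fun_diff:
  assumes "test_fun \<Omega> \<phi> D" "test_fun \<Omega> \<psi> E"
  shows "test_fun \<Omega> (\<lambda>x. \<phi> x - \<psi> x) (\<lambda>x. D x - E x)"
  using test_fun_add[OF assms(1) test_fun_scale[OF assms(2), of "-1"]] by simp

section \<open>Integration by parts and the Poincare inequality for test functions\<close>

lemma test_fun_integral_translate:
  assumes t: "test_fun \<Omega> \<phi> D"
  shows "integrable lborel \<phi>" "integrable lborel (\<lambda>x. \<phi> (x + c))"
    "integral\<^sup>L lborel (\<lambda>x. \<phi> (x + c)) = integral\<^sup>L lborel \<phi>"
proof -
  have [measurable]: "\<phi> \<in> borel_measurable borel" using test_fun_borel[OF t] by simp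
  have "integrable lborel (\<lambda>x. indicator (closure {x. \<phi> x \<noteq> 0}) x *\<^sub>R \<phi> x)"
    using t by (intro borel_integrable_compact continuous_on_subset[OF test_fun_continuous(1)[OF t] subset_UNIV]) (simp add: test_fun_def)
  moreover have "indicator (closure {x. \<phi> x \<noteq> 0}) x *\<^sub>R \<phi> x = \<phi> x" for x
    using test_fun_outside(1)[OF t, of x] by (cases "x \<in> closure {x. \<phi> x \<noteq> 0}") simp_all
  ultimately show 1: "integrable lborel \<phi>" by (simp only:)
  have d: "distr lborel borel ((+) c) = lborel" by (rule lborel_distr_plus)
  have "integrable (distr lborel borel ((+) c)) \<phi>" using 1 by (simp add: d)
  then show "integrable lborel (\<lambda>x. \<phi> (x + c))"
    by (subst (asm) integrable_distr_eq) (auto simp: add.commute)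
  have "integral\<^sup>L (distr lborel borel ((+) c)) \<phi> = integral\<^sup>L lborel (\<lambda>x. \<phi> (c + x))"
    by (subst integral_distr) auto
  then show "integral\<^sup>L lborel (\<lambda>x. \<phi> (x + c)) = integral\<^sup>L lborel \<phi>" by (simp add: d add.commute)
qed

text \<open>Difference quotients in direction \<open>e\<close> have integral zero by translation
  invariance, and dominated convergence passes to the derivative. The integral is over the whole
  space, since a translated support may leave \<Omega>.\<close>

lemma test_fun_integral_directional:
  fixes \<Omega> :: "'a::euclidean_space set"
  assumes t: "test_fun \<Omega> \<phi> D"
  shows "integral\<^sup>L lborel (\<lambda>x. D x \<bullet> e) = 0"
proof -
  have [measurable]: "\<phi> \<in> borel_measurable borel" "D \<in> borel_measurable borel" using test_fun_borel[OF t] by auto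
  define s where "s n x = (\<phi> (x + inverse (real (Suc n)) *\<^sub>R e) - \<phi> x) / inverse (real (Suc n))" for n x
  obtain C where C: "\<And>x. norm (D x) \<le> C" using test_fun_bounded[OF t] by blast
  have "C \<ge> 0" using C[of 0] norm_ge_zero order_trans by blast
  obtain R where R: "\<And>x. x \<in> closure {x. \<phi> x \<noteq> 0} \<Longrightarrow> norm x \<le> R"
    using t by (auto simp: test_fun_def compact_eq_bounded_closed bounded_iff)
  have z: "\<phi> x = 0" if "norm x > R" for x
    using R[of x] that test_fun_outside(1)[OF t, of x] by linarith
  have [measurable]: "s n \<in> borel_measurable borel" for n unfolding s_def by measurable
  have s0: "integral\<^sup>L lborel (s n) = 0" for n
    unfolding s_def using test_fun_integral_translate[OF t] by simp
  have lim: "(\<lambda>n. s n x) \<longlonglongrightarrow> D x \<bullet> e" for x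
  proof -
    have "((\<lambda>t. \<phi> (x + t *\<^sub>R e)) has_derivative (\<lambda>t. D x \<bullet> (t *\<^sub>R e))) (at 0)"
      by (rule has_derivative_compose[where g=\<phi> and f="\<lambda>t. x + t *\<^sub>R e"])
         (auto intro!: derivative_eq_intros simp: test_fun_derivative[OF t])
    then have "((\<lambda>t. \<phi> (x + t *\<^sub>R e)) has_real_derivative (D x \<bullet> e)) (at 0)"
      unfolding has_field_derivative_def by (rule has_derivative_eq_rhs) (simp add: fun_eq_iff)
    then have "(\<lambda>h. (\<phi> (x + (0 + h) *\<^sub>R e) - \<phi> (x + 0 *\<^sub>R e)) / h) \<midarrow>0\<rightarrow> D x \<bullet> e"
      by (rule DERIV_D)
    then have L: "(\<lambda>h. (\<phi> (x + h *\<^sub>R e) - \<phi> x) / h) \<midarrow>0\<rightarrow> D x \<bullet> e" by simp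
    have "filterlim (\<lambda>n. inverse (real (Suc n))) (at 0) sequentially"
      using LIMSEQ_inverse_real_of_nat by (simp add: filterlim_at)
    from filterlim_compose[OF L this] show ?thesis by (simp add: s_def)
  qed
  \<comment> \<open>The step sizes are at most 1, so every quotient vanishes outside the ball of
    radius \<open>R + norm e\<close>; inside it the mean value inequality gives the bound
    \<open>C * norm e\<close>.\<close>
  have bd: "norm (s n x) \<le> C * norm e * indicator (cball 0 (R + norm e)) x" for n x
  proof (cases "norm x \<le> R + norm e")
    case True
    have "norm (\<phi> (x + inverse (real (Suc n)) *\<^sub>R e) - \<phi> x) \<le> C * norm ((x + inverse (real (Suc n)) *\<^sub>R e) - x)"
    proof (rule differentiable_bound[of UNIV _ "\<lambda>x h. D x \<bullet> h"])
      show "onorm (\<lambda>h. D x \<bullet> h) \<le> C" for x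
        by (rule onorm_le) (use C in \<open>auto intro!: order_trans[OF Cauchy_Schwarz_ineq2] mult_right_mono\<close>)
    qed (auto simp: test_fun_derivative[OF t])
    also have "\<dots> = C * norm e * inverse (real (Suc n))" by simp
    finally have le: "norm (\<phi> (x + inverse (real (Suc n)) *\<^sub>R e) - \<phi> x) \<le> C * norm e * inverse (real (Suc n))" .
    have p: "inverse (real (Suc n)) > 0" by simp
    have "norm (s n x) = norm (\<phi> (x + inverse (real (Suc n)) *\<^sub>R e) - \<phi> x) / inverse (real (Suc n))"
      unfolding s_def real_norm_def abs_divide abs_of_pos[OF p] ..
    also have "\<dots> \<le> C * norm e" using le unfolding pos_divide_le_eq[OF p] .
    finally show ?thesis using True by simp
  next
    case False
    have "norm (inverse (real (Suc n)) *\<^sub>R e) \<le> norm e"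
      by (simp add: field_simps)
    then have "norm (x + inverse (real (Suc n)) *\<^sub>R e) > R"
      using False norm_triangle_ineq4[of "x + inverse (real (Suc n)) *\<^sub>R e" "inverse (real (Suc n)) *\<^sub>R e"]
      by auto
    moreover have "norm x > R" using False norm_ge_zero[of e] by linarith
    ultimately have "s n x = 0" by (simp add: s_def z)
    then show ?thesis using \<open>C \<ge> 0\<close> by simp
  qed
  have "(\<lambda>n. integral\<^sup>L lborel (s n)) \<longlonglongrightarrow> integral\<^sup>L lborel (\<lambda>x. D x \<bullet> e)"
  proof (rule integral_dominated_convergence)
    show "integrable lborel (\<lambda>x. C * norm e * indicator (cball (0::'a) (R + norm e)) x)"
      using emeasure_bounded_finite[OF bounded_cball[of "0::'a" "R + norm e"]]
      by (intro integrable_mult_right integrable_real_indicator) auto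
  qed (use lim bd in auto)
  then show ?thesis unfolding s0 using LIMSEQ_unique[OF _ tendsto_const] by metis
qed

lemma test_fun_integral_grad:
  assumes t: "test_fun \<Omega> \<phi> D" and \<Omega>: "\<Omega> \<in> lmeasurable"
  shows "integral\<^sup>L (lebesgue_on \<Omega>) D = 0"
proof (rule euclidean_eqI)
  fix b :: 'a assume "b \<in> Basis"
  have [measurable]: "D \<in> borel_measurable borel" using test_fun_borel[OF t] by auto
  have "integral\<^sup>L (lebesgue_on \<Omega>) D \<bullet> b = integral\<^sup>L (lebesgue_on \<Omega>) (\<lambda>x. D x \<bullet> b)"
    using L2_on_integrable[OF \<Omega> test_fun_L2(2)[OF \<Omega> t]] by simp
  also have "\<dots> = integral\<^sup>L lebesgue (\<lambda>x. indicator \<Omega> x *\<^sub>R (D x \<bullet> b))"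
    using \<Omega> by (intro integral_restrict_space) (auto intro: fmeasurableD)
  also have "(\<lambda>x. indicator \<Omega> x *\<^sub>R (D x \<bullet> b)) = (\<lambda>x. D x \<bullet> b)"
    using test_fun_outside_domain(2)[OF t] by (auto simp: indicator_def fun_eq_iff)
  also have "integral\<^sup>L lebesgue (\<lambda>x. D x \<bullet> b) = integral\<^sup>L lborel (\<lambda>x. D x \<bullet> b)"
    by (intro integral_completion) measurable
  finally show "integral\<^sup>L (lebesgue_on \<Omega>) D \<bullet> b = 0 \<bullet> b"
    using test_fun_integral_directional[OF t] by simp
qed

text \<open>Integration by parts is the vanishing integral of the gradient of the product of two
  test functions.\<close>

lemma test_fun_weak_grad:
  assumes t: "test_fun \<Omega> \<phi> D" and \<Omega>: "\<Omega> \<in> lmeasurable"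
  shows "weak_grad \<Omega> \<phi> D"
  unfolding weak_grad_def
proof (intro allI impI)
  fix \<psi> E assume u: "test_fun \<Omega> \<psi> E"
  note L = test_fun_L2[OF \<Omega> t] test_fun_L2[OF \<Omega> u]
  have "test_fun \<Omega> (\<lambda>x. \<phi> x * \<psi> x) (\<lambda>x. \<phi> x *\<^sub>R E x + \<psi> x *\<^sub>R D x)"
    by (rule test_fun_mult_C1[OF u test_fun_derivative[OF t] test_fun_continuous(2)[OF t]])
  from test_fun_integral_grad[OF this \<Omega>]
  have "integral\<^sup>L (lebesgue_on \<Omega>) (\<lambda>x. \<phi> x *\<^sub>R E x) + integral\<^sup>L (lebesgue_on \<Omega>) (\<lambda>x. \<psi> x *\<^sub>R D x) = 0"
    using L by (simp add: L2_on_integrable_scaleR)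
  then show "integral\<^sup>L (lebesgue_on \<Omega>) (\<lambda>x. \<phi> x *\<^sub>R E x) = - integral\<^sup>L (lebesgue_on \<Omega>) (\<lambda>x. \<psi> x *\<^sub>R D x)"
    by (simp add: eq_neg_iff_add_eq_0)
qed

text \<open>The gradient of (x . b) \<phi>^2 has integral zero. Its \<open>b\<close> component is
  \<phi>^2 + 2 (x . b) \<phi> (D . b), and |x . b| is at most \<open>R\<close> on \<Omega>, so the
  second term is absorbed into the first at the cost of the gradient.\<close>

lemma test_fun_Poincare:
  fixes \<Omega> :: "'a::euclidean_space set"
  assumes t: "test_fun \<Omega> \<phi> D" and \<Omega>: "\<Omega> \<in> lmeasurable" and R: "\<And>x. x \<in> \<Omega> \<Longrightarrow> norm x \<le> R"
  shows "integral\<^sup>L (lebesgue_on \<Omega>) (\<lambda>x. (norm (\<phi> x))\<^sup>2) \<le> 4 * R\<^sup>2 * integral\<^sup>L (lebesgue_on \<Omega>) (\<lambda>x. (norm (D x))\<^sup>2)"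
proof -
  obtain b :: 'a where b: "b \<in> Basis" using nonempty_Basis by blast
  let ?E = "\<lambda>x. \<phi> x *\<^sub>R ((x \<bullet> b) *\<^sub>R D x + \<phi> x *\<^sub>R b) + ((x \<bullet> b) * \<phi> x) *\<^sub>R D x"
  have t1: "test_fun \<Omega> (\<lambda>x. (x \<bullet> b) * \<phi> x) (\<lambda>x. (x \<bullet> b) *\<^sub>R D x + \<phi> x *\<^sub>R b)"
    by (rule test_fun_mult_C1[OF t]) (auto intro!: derivative_eq_intros simp: inner_commute)
  have t2: "test_fun \<Omega> (\<lambda>x. \<phi> x * ((x \<bullet> b) * \<phi> x)) ?E"
    by (rule test_fun_mult_C1[OF t1 test_fun_derivative[OF t] test_fun_continuous(2)[OF t]])
  note L = test_fun_L2[OF \<Omega> t] test_fun_L2(2)[OF \<Omega> t2]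
  have iE: "integrable (lebesgue_on \<Omega>) ?E" by (rule L2_on_integrable[OF \<Omega> L(3)])
  have i: "integrable (lebesgue_on \<Omega>) (\<lambda>x. (norm (\<phi> x))\<^sup>2)" "integrable (lebesgue_on \<Omega>) (\<lambda>x. (norm (D x))\<^sup>2)"
    using L by (auto simp: L2_on_def)
  have "(1/2) * integral\<^sup>L (lebesgue_on \<Omega>) (\<lambda>x. (norm (\<phi> x))\<^sup>2) - 2 * R\<^sup>2 * integral\<^sup>L (lebesgue_on \<Omega>) (\<lambda>x. (norm (D x))\<^sup>2)
     = integral\<^sup>L (lebesgue_on \<Omega>) (\<lambda>x. (1/2) * (norm (\<phi> x))\<^sup>2 - 2 * R\<^sup>2 * (norm (D x))\<^sup>2)"
    using i by simp
  also have "\<dots> \<le> integral\<^sup>L (lebesgue_on \<Omega>) (\<lambda>x. ?E x \<bullet> b)"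
  proof (rule integral_mono)
    fix x assume "x \<in> space (lebesgue_on \<Omega>)"
    then have x: "norm x \<le> R" using R by (simp add: space_restrict_space)
    have bb: "b \<bullet> b = 1" using b by simp
    let ?p = "(x \<bullet> b) * (D x \<bullet> b)"
    have "\<bar>x \<bullet> b\<bar> \<le> R" "\<bar>D x \<bullet> b\<bar> \<le> norm (D x)"
      using Basis_le_norm[OF b] x order_trans by blast+
    then have "\<bar>?p\<bar> \<le> R * norm (D x)" unfolding abs_mult by (intro mult_mono) auto
    then have "?p\<^sup>2 \<le> (R * norm (D x))\<^sup>2" by (simp add: abs_le_square_iff[symmetric])
    \<comment> \<open>Young's inequality, balanced so that exactly half of \<phi>^2 survives; this
      is the source of the constant 4 R^2.\<close>
    moreover have "0 \<le> (\<phi> x + 2 * ?p)\<^sup>2" by simp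
    ultimately have "(1/2) * (\<phi> x)\<^sup>2 - 2 * (R * norm (D x))\<^sup>2 \<le> (\<phi> x)\<^sup>2 + 2 * \<phi> x * ?p"
      by (simp add: power2_eq_square algebra_simps)
    then show "(1/2) * (norm (\<phi> x))\<^sup>2 - 2 * R\<^sup>2 * (norm (D x))\<^sup>2 \<le> ?E x \<bullet> b"
      using bb by (simp add: power2_eq_square algebra_simps)
  qed (use i iE in auto)
  also have "\<dots> = integral\<^sup>L (lebesgue_on \<Omega>) ?E \<bullet> b" using iE by (rule integral_inner_left)
  also have "\<dots> = 0" using test_fun_integral_grad[OF t2 \<Omega>] by simp
  finally show ?thesis by simp
qed

section \<open>Uniqueness of the weak gradient\<close>

text \<open>Squaring removes the kink of the positive part: at 0 the difference quotient is
  \<open>max 0 h\<close>. This gives C^1 bumps without exponentials.\<close>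

lemma has_derivative_max_zero_square:
  "((\<lambda>s::real. (max 0 s)\<^sup>2) has_real_derivative 2 * max 0 s) (at s)"
proof -
  consider "s < 0" | "s = 0" | "s > 0" by linarith
  then show ?thesis
  proof cases
    case 1
    have "((\<lambda>s::real. 0) has_real_derivative 2 * max 0 s) (at s)" using 1 by simp
    then show ?thesis by (rule has_field_derivative_transform_within_open[where S="{..<0}"]) (use 1 in auto)
  next
    case 2
    have "((\<lambda>h::real. max 0 h) \<longlongrightarrow> max 0 0) (at 0)" by (intro tendsto_intros)
    moreover have "(max 0 h)\<^sup>2 / h = max 0 h" for h :: real by (auto simp: max_def power2_eq_square)
    ultimately show ?thesis using 2 by (simp add: has_field_derivative_iff)
  next
    case 3
    have "((\<lambda>s::real. s\<^sup>2) has_real_derivative 2 * max 0 s) (at s)" using 3 by (auto intro!: derivative_eq_intros)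
    then show ?thesis by (rule has_field_derivative_transform_within_open[where S="{0<..}"]) (use 3 in auto)
  qed
qed

text \<open>The bump is the squared positive part of r^2 - |x - c|^2. Being positive exactly on the
  open ball, it has its support in the closed ball, which is why the closed ball must lie in
  \<Omega>.\<close>

lemma test_fun_ball:
  fixes c :: "'a::euclidean_space"
  assumes "cball c r \<subseteq> \<Omega>"
  shows "\<exists>q D. test_fun \<Omega> q D \<and> (\<forall>x. 0 \<le> q x) \<and> (\<forall>x. 0 < q x \<longleftrightarrow> x \<in> ball c r)"
proof (cases "r > 0")
  case False
  then have b: "ball c r = {}" by simp
  show ?thesis unfolding b by (intro exI[of _ "\<lambda>x. 0"]) (simp add: test_fun_zero)
next
  case True
  define p where "p x = r\<^sup>2 - (x - c) \<bullet> (x - c)" for x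
  define q where "q x = (max 0 (p x))\<^sup>2" for x
  \<comment> \<open>Chain rule: twice the positive part, times the gradient -2 (x - c) of
    \<open>p\<close>.\<close>
  define D where "D x = (- 4 * max 0 (p x)) *\<^sub>R (x - c)" for x
  have p: "p x > 0 \<longleftrightarrow> x \<in> ball c r" for x
  proof -
    have "p x > 0 \<longleftrightarrow> (norm (x - c))\<^sup>2 < r\<^sup>2" by (simp add: p_def power2_norm_eq_inner)
    also have "\<dots> \<longleftrightarrow> norm (x - c) < r" using True by (auto intro: power2_less_imp_less power_strict_mono)
    finally show ?thesis by (simp add: dist_norm norm_minus_commute)
  qed
  have q: "0 < q x \<longleftrightarrow> x \<in> ball c r" for x unfolding p[symmetric] by (auto simp: q_def max_def)
  have cl: "closure {x. q x \<noteq> 0} \<subseteq> cball c r"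
  proof (rule closure_minimal)
    show "{x. q x \<noteq> 0} \<subseteq> cball c r"
    proof
      fix x assume "x \<in> {x. q x \<noteq> 0}"
      then have "q x \<noteq> 0" by (rule CollectD)
      moreover have "0 \<le> q x" by (simp add: q_def)
      ultimately have "0 < q x" by linarith
      then have "x \<in> ball c r" by (rule iffD1[OF q])
      then show "x \<in> cball c r" by simp
    qed
  qed simp
  have "test_fun \<Omega> q D"
    unfolding test_fun_def
  proof (intro conjI allI)
    fix x
    have "(p has_derivative (\<lambda>h. - 2 * ((x - c) \<bullet> h))) (at x)"
      unfolding p_def by (auto intro!: derivative_eq_intros simp: algebra_simps inner_commute)
    from has_derivative_compose[OF this, of "\<lambda>s. (max 0 s)\<^sup>2", OF has_derivative_max_zero_square[unfolded has_field_derivative_def]]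
    show "(q has_derivative (\<lambda>h. D x \<bullet> h)) (at x)"
      unfolding q_def by (rule has_derivative_eq_rhs) (simp add: fun_eq_iff D_def)
  next
    show "continuous_on UNIV D" unfolding D_def p_def by (intro continuous_intros)
    show "compact (closure {x. q x \<noteq> 0})" by (rule compact_closed_subset[OF compact_cball closed_closure cl])
    show "closure {x. q x \<noteq> 0} \<subseteq> \<Omega>" using cl assms by blast
  qed
  moreover have "0 \<le> q x" for x by (simp add: q_def)
  ultimately show ?thesis using q by blast
qed

lemma test_fun_sum:
  assumes "\<And>i. test_fun \<Omega> (q i) (D i)"
  shows "test_fun \<Omega> (\<lambda>x. \<Sum>i<n::nat. q i x) (\<lambda>x. \<Sum>i<n. D i x)"
  by (induction n) (auto simp: test_fun_zero intro!: test_fun_add assms)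

text \<open>The map s -> k s / (1 + k s) sends [0, oo) into [0, 1) and fixes 0, so it bounds
  \<open>q\<close> without enlarging its support; as \<open>k\<close> grows it approaches the
  indicator of s > 0.\<close>

lemma test_fun_saturate:
  assumes t: "test_fun \<Omega> q D" and q: "\<And>x. 0 \<le> q x" and k: "0 \<le> k"
  shows "test_fun \<Omega> (\<lambda>x. k * q x / (1 + k * q x)) (\<lambda>x. (k / (1 + k * q x)\<^sup>2) *\<^sub>R D x)"
  unfolding test_fun_def
proof (intro conjI allI)
  fix x
  have nz: "1 + k * q x \<noteq> 0" for x using mult_nonneg_nonneg[OF k q[of x]] by linarith
  have "((\<lambda>s. k * s / (1 + k * s)) has_real_derivative k / (1 + k * q x)\<^sup>2) (at (q x))"
    using nz[of x] by (auto intro!: derivative_eq_intros simp: field_simps power2_eq_square)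
  from has_derivative_compose[OF test_fun_derivative[OF t, of x] this[unfolded has_field_derivative_def]]
  show "((\<lambda>x. k * q x / (1 + k * q x)) has_derivative (\<lambda>h. ((k / (1 + k * q x)\<^sup>2) *\<^sub>R D x) \<bullet> h)) (at x)"
    by (rule has_derivative_eq_rhs) (simp add: fun_eq_iff)
  show "continuous_on UNIV (\<lambda>x. (k / (1 + k * q x)\<^sup>2) *\<^sub>R D x)"
    using test_fun_continuous[OF t] nz by (intro continuous_intros) auto
  have s: "closure {x. k * q x / (1 + k * q x) \<noteq> 0} \<subseteq> closure {x. q x \<noteq> 0}" by (rule closure_mono) auto
  show "compact (closure {x. k * q x / (1 + k * q x) \<noteq> 0})"
    by (rule compact_closed_subset[OF _ closed_closure s]) (use t in \<open>simp add: test_fun_def\<close>)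
  show "closure {x. k * q x / (1 + k * q x) \<noteq> 0} \<subseteq> \<Omega>"
    using s t unfolding test_fun_def by blast
qed

text \<open>\<open>U\<close> is a countable union of balls whose closures lie in \<open>U\<close>.
  The finite sum of the first \<open>k\<close> bumps has compact support, and saturating it with
  parameter \<open>k\<close> both exhausts \<open>U\<close> and drives the values to 1.\<close>

lemma test_fun_approx_open:
  fixes U :: "'a::euclidean_space set"
  assumes U: "open U" "U \<subseteq> \<Omega>"
  obtains \<phi> D where "\<And>k::nat. test_fun \<Omega> (\<phi> k) (D k)" "\<And>k x. \<bar>\<phi> k x\<bar> \<le> 1"
    "\<And>x. (\<lambda>k. \<phi> k x) \<longlonglongrightarrow> indicator U x"
proof -
  let ?F = "{ball c r |c r. cball c r \<subseteq> U}"
  obtain F where F: "F \<subseteq> ?F" "countable F" "\<Union>F = \<Union>?F"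
    using Lindelof[of ?F] by auto
  have UF: "\<Union>?F = U"
  proof
    show "\<Union>?F \<subseteq> U" using ball_subset_cball by blast
    show "U \<subseteq> \<Union>?F"
    proof
      fix x assume "x \<in> U"
      then obtain e where "e > 0" "cball x e \<subseteq> U" using U(1) open_contains_cball by blast
      then show "x \<in> \<Union>?F" using centre_in_ball by blast
    qed
  qed
  \<comment> \<open>Adding the empty set makes the family nonempty, so that the naturals enumerate
    it; the empty set receives the zero function.\<close>
  define B where "B = from_nat_into (insert {} F)"
  have rB: "range B = insert {} F" unfolding B_def using F(2) by (intro range_from_nat_into) auto
  have BU: "(\<Union>i. B i) = U" unfolding rB using F(3) UF by simp
  have "\<exists>q D. test_fun \<Omega> q D \<and> (\<forall>x. 0 \<le> q x) \<and> (\<forall>x. 0 < q x \<longleftrightarrow> x \<in> B i)" for i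
  proof (cases "B i = {}")
    case True
    then show ?thesis using test_fun_zero[of \<Omega>] by (intro exI[of _ "\<lambda>x. 0"]) auto
  next
    case False
    then have "B i \<in> ?F" using rB F(1) by blast
    then obtain c r where "B i = ball c r" "cball c r \<subseteq> \<Omega>" using U(2) by blast
    then show ?thesis using test_fun_ball by metis
  qed
  then obtain q D where q: "\<And>i. test_fun \<Omega> (q i) (D i)" "\<And>i x. 0 \<le> q i x" "\<And>i x. 0 < q i x \<longleftrightarrow> x \<in> B i"
    by metis
  define Q where "Q k x = (\<Sum>i<k::nat. q i x)" for k x
  have Q0: "0 \<le> real k * Q k x" for k x unfolding Q_def by (intro mult_nonneg_nonneg sum_nonneg q) simp
  define \<phi> where "\<phi> k x = real k * Q k x / (1 + real k * Q k x)" for k x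
  define E where "E k x = (real k / (1 + real k * Q k x)\<^sup>2) *\<^sub>R (\<Sum>i<k. D i x)" for k x
  have "test_fun \<Omega> (\<phi> k) (E k)" for k
    using test_fun_saturate[OF test_fun_sum[where q=q and D=D and n=k, OF q(1)], where k="real k"] q(2)
    unfolding \<phi>_def E_def Q_def by (simp add: sum_nonneg)
  moreover have "\<bar>\<phi> k x\<bar> \<le> 1" for k x
    using Q0[of k x] by (simp add: \<phi>_def)
  moreover have "(\<lambda>k. \<phi> k x) \<longlonglongrightarrow> indicator U x" for x
  proof (cases "x \<in> U")
    case False
    then have "x \<notin> B i" for i unfolding BU[symmetric] by blast
    then have "q i x = 0" for i using q(2,3)[of i x] by (metis order_le_less)
    then show ?thesis using False by (simp add: \<phi>_def Q_def)
  next
    case True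
    then obtain j where "x \<in> B j" unfolding BU[symmetric] by blast
    then have qj: "q j x > 0" using q(3) by blast
    \<comment> \<open>Once \<open>k > j\<close>, the partial sum contains the bump positive at
      \<open>x\<close>, so 1 - \<phi> k x = 1 / (1 + k Q) is at most 1 / (k q j x).\<close>
    have "(\<lambda>k. 1 - \<phi> k x) \<longlonglongrightarrow> 0"
    proof (rule Lim_null_comparison)
      show "(\<lambda>k. inverse (q j x) * inverse (real k)) \<longlonglongrightarrow> 0"
        by (rule tendsto_mult_right_zero[OF lim_inverse_n])
      show "\<forall>\<^sub>F k in sequentially. norm (1 - \<phi> k x) \<le> inverse (q j x) * inverse (real k)"
        using eventually_gt_at_top[of j]
      proof eventually_elim
        case (elim k)
        then have k: "real k > 0" by simp
        have "q j x \<le> Q k x" unfolding Q_def using elim q(2) by (intro member_le_sum) auto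
        then have le: "q j x * real k \<le> 1 + real k * Q k x" using k by (simp add: mult.commute add_increasing)
        have pos: "1 + real k * Q k x > 0" using Q0[of k x] by linarith
        then have "1 - \<phi> k x = inverse (1 + real k * Q k x)" by (simp add: \<phi>_def field_simps)
        moreover have "inverse (1 + real k * Q k x) \<le> inverse (q j x * real k)"
          using le qj k by (intro le_imp_inverse_le) auto
        ultimately show ?case using pos by (simp add: inverse_mult_distrib)
      qed
    qed
    then have "(\<lambda>k. 1 - (1 - \<phi> k x)) \<longlonglongrightarrow> 1 - 0" by (intro tendsto_intros)
    then show ?thesis using True by simp
  qed
  ultimately show ?thesis using that by blast
qed

text \<open>A function whose integral vanishes over every measurable set is zero almost everywhere.
  Test functions reach indicators of open sets by bounded limits, a Dynkin argument reaches Borel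
  sets, and Lebesgue sets differ from Borel sets by null sets.\<close>

lemma test_fun_fundamental_lemma:
  fixes f :: "'a::euclidean_space \<Rightarrow> 'b::euclidean_space"
  assumes \<Omega>: "open \<Omega>" "\<Omega> \<in> lmeasurable" and f: "integrable (lebesgue_on \<Omega>) f"
    and zero: "\<And>\<phi> D. test_fun \<Omega> \<phi> D \<Longrightarrow> integral\<^sup>L (lebesgue_on \<Omega>) (\<lambda>x. \<phi> x *\<^sub>R f x) = 0"
  shows "AE x in lebesgue_on \<Omega>. f x = 0"
proof -
  let ?M = "lebesgue_on \<Omega>"
  interpret finite_measure ?M by (rule finite_measure_lebesgue_on[OF \<Omega>(2)])
  have leb: "A \<inter> \<Omega> \<in> sets ?M" if "A \<in> sets borel" for A
    using that \<Omega> by (auto simp: sets_restrict_space)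
  have [measurable]: "f \<in> borel_measurable ?M" using f by simp
  have sint: "set_integrable ?M (A \<inter> \<Omega>) f" if "A \<in> sets borel" for A
    unfolding set_integrable_def using integrable_mult_indicator[OF leb[OF that] f] .
  have op: "set_lebesgue_integral ?M (U \<inter> \<Omega>) f = 0" if U: "open U" for U
  proof -
    obtain \<phi> D where \<phi>: "\<And>k::nat. test_fun \<Omega> (\<phi> k) (D k)" "\<And>k x. \<bar>\<phi> k x\<bar> \<le> 1"
      "\<And>x. (\<lambda>k. \<phi> k x) \<longlonglongrightarrow> indicator (U \<inter> \<Omega>) x"
      using test_fun_approx_open[of "U \<inter> \<Omega>" \<Omega>] U \<Omega> by blast
    have [measurable]: "\<phi> k \<in> borel_measurable ?M" for k
      by (rule borel_measurable_lebesgue_on[OF test_fun_borel(1)[OF \<phi>(1)]])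
    have [measurable]: "U \<inter> \<Omega> \<in> sets ?M" using leb U by simp
    have "(\<lambda>k. integral\<^sup>L ?M (\<lambda>x. \<phi> k x *\<^sub>R f x)) \<longlonglongrightarrow> integral\<^sup>L ?M (\<lambda>x. indicator (U \<inter> \<Omega>) x *\<^sub>R f x)"
    proof (rule integral_dominated_convergence)
      show "integrable ?M (\<lambda>x. norm (f x))" using f by simp
      show "AE x in ?M. (\<lambda>k. \<phi> k x *\<^sub>R f x) \<longlonglongrightarrow> indicator (U \<inter> \<Omega>) x *\<^sub>R f x"
        by (intro AE_I2 tendsto_intros \<phi>(3))
      show "AE x in ?M. norm (\<phi> k x *\<^sub>R f x) \<le> norm (f x)" for k
        using \<phi>(2) by (auto intro!: AE_I2 mult_left_le_one_le)
    qed measurable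
    then have "(\<lambda>k::nat. 0) \<longlonglongrightarrow> integral\<^sup>L ?M (\<lambda>x. indicator (U \<inter> \<Omega>) x *\<^sub>R f x)"
      by (simp add: zero[OF \<phi>(1)])
    then show ?thesis unfolding set_lebesgue_integral_def using LIMSEQ_unique[OF _ tendsto_const] by metis
  qed
  \<comment> \<open>The complement case of the Dynkin argument subtracts from the integral over all
    of \<Omega>, which must therefore vanish first.\<close>
  have all: "set_lebesgue_integral ?M \<Omega> f = 0" using op[of UNIV] by simp
  have bor: "set_lebesgue_integral ?M (A \<inter> \<Omega>) f = 0" if "A \<in> sets borel" for A
  proof -
    have sb: "sets (borel :: 'a measure) = sigma_sets UNIV {S. open S}" by (simp add: borel_def)
    have "Int_stable {S :: 'a set. open S}" "{S :: 'a set. open S} \<subseteq> Pow UNIV"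
      by (auto simp: Int_stable_def)
    moreover have "A \<in> sigma_sets UNIV {S. open S}" using that sb by simp
    ultimately show ?thesis
    \<comment> \<open>Open sets are closed under intersection, so it suffices to treat complements
      and disjoint countable unions.\<close>
    proof (induct rule: sigma_sets_induct_disjoint)
      case (compl A)
      then have A: "A \<in> sets borel" using sb by simp
      have "\<Omega> = (A \<inter> \<Omega>) \<union> ((UNIV - A) \<inter> \<Omega>)" by blast
      then have "set_lebesgue_integral ?M \<Omega> f
         = set_lebesgue_integral ?M (A \<inter> \<Omega>) f + set_lebesgue_integral ?M ((UNIV - A) \<inter> \<Omega>) f"
        using set_integral_Un[of "A \<inter> \<Omega>" "(UNIV - A) \<inter> \<Omega>" ?M f] sint[OF A] sint[of "UNIV - A"] A
        by (metis (no_types, lifting) Diff_disjoint Int_assoc Int_commute Int_empty_right borel_comp Compl_eq_Diff_UNIV)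
      then show ?case using compl all by simp
    next
      case (union A)
      then have A: "A i \<in> sets borel" for i using sb by blast
      have "set_lebesgue_integral ?M (\<Union>i. A i \<inter> \<Omega>) f = (\<Sum>i. set_lebesgue_integral ?M (A i \<inter> \<Omega>) f)"
      proof (rule lebesgue_integral_countable_add)
        show "A i \<inter> \<Omega> \<in> sets ?M" for i by (rule leb[OF A])
        show "(A i \<inter> \<Omega>) \<inter> (A j \<inter> \<Omega>) = {}" if "i \<noteq> j" for i j
          using union(1) that by (auto simp: disjoint_family_on_def)
        have "(\<Union>i. A i) \<in> sets borel" using A by blast
        from sint[OF this] show "set_integrable ?M (\<Union>i. A i \<inter> \<Omega>) f" by (simp add: Int_commute)
      qed
      then show ?case using union by (simp add: Int_commute)
    next
      case empty
      show ?case by (simp add: set_lebesgue_integral_def)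
    qed (simp add: op)
  qed
  show ?thesis
  proof (rule density_zero[OF f])
    fix A assume AM: "A \<in> sets ?M"
    then have A: "A \<in> sets lebesgue" "A \<subseteq> \<Omega>" using \<Omega> by (auto simp: sets_restrict_space)
    \<comment> \<open>Only the Borel part \<open>S\<close> matters; the rest of \<open>A\<close>
      sits in the null set \<open>N'\<close>.\<close>
    obtain S N N' where S: "A = S \<union> N" "N \<subseteq> N'" "N' \<in> null_sets lborel" "S \<in> sets lborel"
      using A(1) by (rule sets_completionE)
    have "AE x in lebesgue. x \<notin> N'" using AE_completion[OF AE_not_in[OF S(3)]] .
    then have "AE x in ?M. x \<notin> N'" using \<Omega> by (subst AE_restrict_space_iff) auto
    then have ae: "AE x in ?M. indicator A x *\<^sub>R f x = indicator (S \<inter> \<Omega>) x *\<^sub>R f x"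
      by eventually_elim (use S A(2) in \<open>auto simp: indicator_def\<close>)
    have Sm: "S \<inter> \<Omega> \<in> sets ?M" using leb S(4) by simp
    have "set_lebesgue_integral ?M A f = set_lebesgue_integral ?M (S \<inter> \<Omega>) f"
      unfolding set_lebesgue_integral_def by (rule integral_cong_AE[OF _ _ ae]) (use AM Sm in measurable)
    then show "set_lebesgue_integral ?M A f = 0" using bor S(4) by simp
  qed
qed

lemma weak_grad_unique:
  assumes \<Omega>: "open \<Omega>" "\<Omega> \<in> lmeasurable" and G: "L2_on \<Omega> G" "weak_grad \<Omega> u G" and H: "L2_on \<Omega> H" "weak_grad \<Omega> u H"
  shows "AE x in lebesgue_on \<Omega>. G x = H x"
proof -
  have "AE x in lebesgue_on \<Omega>. G x - H x = 0"
  proof (rule test_fun_fundamental_lemma[OF \<Omega>])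
    show "integrable (lebesgue_on \<Omega>) (\<lambda>x. G x - H x)" using L2_on_integrable[OF \<Omega>(2) L2_on_diff[OF G(1) H(1)]] .
    fix \<phi> D assume t: "test_fun \<Omega> \<phi> D"
    note L = test_fun_L2[OF \<Omega>(2) t]
    show "integral\<^sup>L (lebesgue_on \<Omega>) (\<lambda>x. \<phi> x *\<^sub>R (G x - H x)) = 0"
      using G(2)[unfolded weak_grad_def, rule_format, OF t] H(2)[unfolded weak_grad_def, rule_format, OF t]
      by (simp add: scaleR_diff_right L2_on_integrable_scaleR L G H)
  qed
  then show ?thesis by simp
qed

section \<open>Sobolev functions\<close>

lemma H1_grad:
  assumes "H1 \<Omega> u"
  shows "L2_on \<Omega> u" "L2_on \<Omega> (grad \<Omega> u)" "weak_grad \<Omega> u (grad \<Omega> u)"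
proof -
  show "L2_on \<Omega> u" using assms by (simp add: H1_def)
  have "\<exists>G. L2_on \<Omega> G \<and> weak_grad \<Omega> u G" using assms by (simp add: H1_def)
  from someI_ex[OF this] show "L2_on \<Omega> (grad \<Omega> u)" "weak_grad \<Omega> u (grad \<Omega> u)"
    by (simp_all add: grad_def)
qed

text \<open>The only access to the value of \<open>grad\<close>, a Hilbert choice: any
  square-integrable weak gradient found by other means agrees with it almost everywhere.\<close>

lemma grad_eq_AE:
  assumes \<Omega>: "open \<Omega>" "\<Omega> \<in> lmeasurable" and "L2_on \<Omega> u" "L2_on \<Omega> G" "weak_grad \<Omega> u G"
  shows "H1 \<Omega> u" "AE x in lebesgue_on \<Omega>. grad \<Omega> u x = G x"
proof -
  show "H1 \<Omega> u" using assms by (auto simp: H1_def)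
  from H1_grad[OF this] show "AE x in lebesgue_on \<Omega>. grad \<Omega> u x = G x"
    using weak_grad_unique[OF \<Omega>] assms by blast
qed

lemma H1_add:
  assumes \<Omega>: "open \<Omega>" "\<Omega> \<in> lmeasurable" and u: "H1 \<Omega> u" and v: "H1 \<Omega> v"
  shows "H1 \<Omega> (\<lambda>x. u x + v x)" "AE x in lebesgue_on \<Omega>. grad \<Omega> (\<lambda>x. u x + v x) x = grad \<Omega> u x + grad \<Omega> v x"
proof -
  note L = H1_grad[OF u] H1_grad[OF v]
  have "weak_grad \<Omega> (\<lambda>x. u x + v x) (\<lambda>x. grad \<Omega> u x + grad \<Omega> v x)"
    unfolding weak_grad_def
  proof (intro allI impI)
    fix \<phi> D assume t: "test_fun \<Omega> \<phi> D"
    note T = test_fun_L2[OF \<Omega>(2) t]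
    show "integral\<^sup>L (lebesgue_on \<Omega>) (\<lambda>x. (u x + v x) *\<^sub>R D x)
      = - integral\<^sup>L (lebesgue_on \<Omega>) (\<lambda>x. \<phi> x *\<^sub>R (grad \<Omega> u x + grad \<Omega> v x))"
      using L(3,6)[unfolded weak_grad_def, rule_format, OF t]
      by (simp add: scaleR_add_right scaleR_add_left L2_on_integrable_scaleR L T)
  qed
  from grad_eq_AE[OF \<Omega> L2_on_add[OF L(1,4)] L2_on_add[OF L(2,5)] this]
  show "H1 \<Omega> (\<lambda>x. u x + v x)" "AE x in lebesgue_on \<Omega>. grad \<Omega> (\<lambda>x. u x + v x) x = grad \<Omega> u x + grad \<Omega> v x" .
qed

lemma H1_diff:
  assumes \<Omega>: "open \<Omega>" "\<Omega> \<in> lmeasurable" and u: "H1 \<Omega> u" and v: "H1 \<Omega> v"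
  shows "H1 \<Omega> (\<lambda>x. u x - v x)" "AE x in lebesgue_on \<Omega>. grad \<Omega> (\<lambda>x. u x - v x) x = grad \<Omega> u x - grad \<Omega> v x"
proof -
  note L = H1_grad[OF u] H1_grad[OF v]
  have "weak_grad \<Omega> (\<lambda>x. u x - v x) (\<lambda>x. grad \<Omega> u x - grad \<Omega> v x)"
    unfolding weak_grad_def
  proof (intro allI impI)
    fix \<phi> D assume t: "test_fun \<Omega> \<phi> D"
    note T = test_fun_L2[OF \<Omega>(2) t]
    show "integral\<^sup>L (lebesgue_on \<Omega>) (\<lambda>x. (u x - v x) *\<^sub>R D x)
      = - integral\<^sup>L (lebesgue_on \<Omega>) (\<lambda>x. \<phi> x *\<^sub>R (grad \<Omega> u x - grad \<Omega> v x))"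
      using L(3,6)[unfolded weak_grad_def, rule_format, OF t]
      by (simp add: scaleR_diff_right scaleR_diff_left L2_on_integrable_scaleR L T)
  qed
  from grad_eq_AE[OF \<Omega> L2_on_diff[OF L(1,4)] L2_on_diff[OF L(2,5)] this]
  show "H1 \<Omega> (\<lambda>x. u x - v x)" "AE x in lebesgue_on \<Omega>. grad \<Omega> (\<lambda>x. u x - v x) x = grad \<Omega> u x - grad \<Omega> v x" .
qed

text \<open>Both sides of the integration by parts identity are continuous under L^2 convergence,
  and the identity holds along the sequence.\<close>

lemma weak_grad_limit:
  assumes \<Omega>: "\<Omega> \<in> lmeasurable" and t: "\<And>k::nat. test_fun \<Omega> (\<phi> k) (D k)"
    and u: "L2_on \<Omega> u" and G: "L2_on \<Omega> G"
    and lu: "(\<lambda>k. integral\<^sup>L (lebesgue_on \<Omega>) (\<lambda>x. (norm (u x - \<phi> k x))\<^sup>2)) \<longlonglongrightarrow> 0"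
    and lG: "(\<lambda>k. integral\<^sup>L (lebesgue_on \<Omega>) (\<lambda>x. (norm (G x - D k x))\<^sup>2)) \<longlonglongrightarrow> 0"
  shows "weak_grad \<Omega> u G"
  unfolding weak_grad_def
proof (intro allI impI)
  fix \<psi> E assume s: "test_fun \<Omega> \<psi> E"
  note T = test_fun_L2[OF \<Omega> t] and S = test_fun_L2[OF \<Omega> s]
  let ?M = "lebesgue_on \<Omega>"
  show "integral\<^sup>L ?M (\<lambda>x. u x *\<^sub>R E x) = - integral\<^sup>L ?M (\<lambda>x. \<psi> x *\<^sub>R G x)"
  proof (rule euclidean_eqI)
    \<comment> \<open>The identity is vector-valued while \<open>weighted_inner\<close> is scalar;
      each component is a pairing with \<open>E . b\<close> on one side and with \<open>b\<close>
      scaled by \<psi> on the other.\<close>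
    fix b :: 'a assume "b \<in> Basis"
    have Eb: "L2_on \<Omega> (\<lambda>x. E x \<bullet> b)"
      by (rule L2_on_bounded_linear[OF bounded_linear_inner_left S(2)])
    have \<psi>b: "L2_on \<Omega> (\<lambda>x. \<psi> x *\<^sub>R b)"
      by (rule L2_on_bounded_linear[OF bounded_linear_scaleR_left S(1)])
    have eq: "integral\<^sup>L ?M (\<lambda>x. v x *\<^sub>R E x) \<bullet> b = weighted_inner \<Omega> (\<lambda>x. 1) v (\<lambda>x. E x \<bullet> b)" if "L2_on \<Omega> v" for v
      using integral_inner_left[OF L2_on_integrable_scaleR[OF that S(2)], of b] by (simp add: weighted_inner_def)
    have eq': "integral\<^sup>L ?M (\<lambda>x. \<psi> x *\<^sub>R H x) \<bullet> b = weighted_inner \<Omega> (\<lambda>x. 1) H (\<lambda>x. \<psi> x *\<^sub>R b)" if "L2_on \<Omega> H" for H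
      using integral_inner_left[OF L2_on_integrable_scaleR[OF S(1) that], of b] by (simp add: weighted_inner_def)
    have "(\<lambda>k. weighted_inner \<Omega> (\<lambda>x. 1) (\<phi> k) (\<lambda>x. E x \<bullet> b)) \<longlonglongrightarrow> weighted_inner \<Omega> (\<lambda>x. 1) u (\<lambda>x. E x \<bullet> b)"
      by (rule weighted_inner_tendsto[OF Linf_on_const T(1) u Eb lu])
    moreover have "(\<lambda>k. - weighted_inner \<Omega> (\<lambda>x. 1) (D k) (\<lambda>x. \<psi> x *\<^sub>R b)) \<longlonglongrightarrow> - weighted_inner \<Omega> (\<lambda>x. 1) G (\<lambda>x. \<psi> x *\<^sub>R b)"
      by (rule tendsto_minus[OF weighted_inner_tendsto[OF Linf_on_const T(2) G \<psi>b lG]])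
    moreover have "weighted_inner \<Omega> (\<lambda>x. 1) (\<phi> k) (\<lambda>x. E x \<bullet> b) = - weighted_inner \<Omega> (\<lambda>x. 1) (D k) (\<lambda>x. \<psi> x *\<^sub>R b)" for k
      unfolding eq[OF T(1), symmetric] eq'[OF T(2), symmetric]
      using test_fun_weak_grad[OF t \<Omega>, unfolded weak_grad_def, rule_format, OF s] by simp
    ultimately have "weighted_inner \<Omega> (\<lambda>x. 1) u (\<lambda>x. E x \<bullet> b) = - weighted_inner \<Omega> (\<lambda>x. 1) G (\<lambda>x. \<psi> x *\<^sub>R b)"
      using LIMSEQ_unique by simp
    then show "integral\<^sup>L ?M (\<lambda>x. u x *\<^sub>R E x) \<bullet> b = (- integral\<^sup>L ?M (\<lambda>x. \<psi> x *\<^sub>R G x)) \<bullet> b"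
      using eq[OF u] eq'[OF G] by simp
  qed
qed

text \<open>A closedness statement that does not presuppose a gradient of \<open>u\<close>: the L^2
  limit \<open>G\<close> of the gradients is shown to be one, and then exchanged for
  \<open>grad\<close> inside the defining integrals of \<open>H1_0\<close>.\<close>

lemma H1_0_limit:
  assumes \<Omega>: "open \<Omega>" "\<Omega> \<in> lmeasurable" and t: "\<And>k::nat. test_fun \<Omega> (\<phi> k) (D k)"
    and u: "L2_on \<Omega> u" and G: "L2_on \<Omega> G"
    and lu: "(\<lambda>k. integral\<^sup>L (lebesgue_on \<Omega>) (\<lambda>x. (norm (u x - \<phi> k x))\<^sup>2)) \<longlonglongrightarrow> 0"
    and lG: "(\<lambda>k. integral\<^sup>L (lebesgue_on \<Omega>) (\<lambda>x. (norm (G x - D k x))\<^sup>2)) \<longlonglongrightarrow> 0"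
  shows "H1_0 \<Omega> u" "AE x in lebesgue_on \<Omega>. grad \<Omega> u x = G x"
proof -
  note g = grad_eq_AE[OF \<Omega> u G weak_grad_limit[OF \<Omega>(2) t u G lu lG]]
  show "AE x in lebesgue_on \<Omega>. grad \<Omega> u x = G x" by (rule g(2))
  have "integral\<^sup>L (lebesgue_on \<Omega>) (\<lambda>x. (norm (grad \<Omega> u x - D k x))\<^sup>2)
      = integral\<^sup>L (lebesgue_on \<Omega>) (\<lambda>x. (norm (G x - D k x))\<^sup>2)" for k
    using g(2) L2_on_measurable[OF H1_grad(2)[OF g(1)]] L2_on_measurable[OF G] L2_on_measurable[OF test_fun_L2(2)[OF \<Omega>(2) t[of k]]]
    by (intro integral_cong_AE) auto
  then show "H1_0 \<Omega> u"
    unfolding H1_0_def using g(1) t tendsto_add[OF lu lG]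
    by (intro conjI exI[of _ \<phi>] exI[of _ D]) auto
qed

lemma H1_0_approx:
  assumes \<Omega>: "\<Omega> \<in> lmeasurable" and u: "H1_0 \<Omega> u"
  obtains \<phi> D where "\<And>k::nat. test_fun \<Omega> (\<phi> k) (D k)"
    "(\<lambda>k. integral\<^sup>L (lebesgue_on \<Omega>) (\<lambda>x. (norm (u x - \<phi> k x))\<^sup>2)) \<longlonglongrightarrow> 0"
    "(\<lambda>k. integral\<^sup>L (lebesgue_on \<Omega>) (\<lambda>x. (norm (grad \<Omega> u x - D k x))\<^sup>2)) \<longlonglongrightarrow> 0"
proof -
  let ?a = "\<lambda>\<phi> k. integral\<^sup>L (lebesgue_on \<Omega>) (\<lambda>x. (norm (u x - \<phi> (k::nat) x))\<^sup>2)"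
  let ?b = "\<lambda>D k. integral\<^sup>L (lebesgue_on \<Omega>) (\<lambda>x. (norm (grad \<Omega> u x - D (k::nat) x))\<^sup>2)"
  obtain \<phi> D where t: "\<And>k::nat. test_fun \<Omega> (\<phi> k) (D k)" and l: "(\<lambda>k. ?a \<phi> k + ?b D k) \<longlonglongrightarrow> 0"
    using u by (auto simp: H1_0_def)
  have nn: "0 \<le> ?a \<phi> k" "0 \<le> ?b D k" for k by simp_all
  have "?a \<phi> \<longlonglongrightarrow> 0" by (rule tendsto_sandwich[OF _ _ tendsto_const l]) (use nn in \<open>auto intro!: always_eventually\<close>)
  moreover have "?b D \<longlonglongrightarrow> 0" by (rule tendsto_sandwich[OF _ _ tendsto_const l]) (use nn in \<open>auto intro!: always_eventually\<close>)
  ultimately show ?thesis using that t by blast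
qed

lemma H1_0_diff:
  assumes \<Omega>: "open \<Omega>" "\<Omega> \<in> lmeasurable" and u: "H1_0 \<Omega> u" and v: "H1_0 \<Omega> v"
  shows "H1_0 \<Omega> (\<lambda>x. u x - v x)"
proof -
  obtain \<phi> D where a: "\<And>k::nat. test_fun \<Omega> (\<phi> k) (D k)"
    "(\<lambda>k. integral\<^sup>L (lebesgue_on \<Omega>) (\<lambda>x. (norm (u x - \<phi> k x))\<^sup>2)) \<longlonglongrightarrow> 0"
    "(\<lambda>k. integral\<^sup>L (lebesgue_on \<Omega>) (\<lambda>x. (norm (grad \<Omega> u x - D k x))\<^sup>2)) \<longlonglongrightarrow> 0"
    using H1_0_approx[OF \<Omega>(2) u] by blast
  obtain \<psi> E where b: "\<And>k::nat. test_fun \<Omega> (\<psi> k) (E k)"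
    "(\<lambda>k. integral\<^sup>L (lebesgue_on \<Omega>) (\<lambda>x. (norm (v x - \<psi> k x))\<^sup>2)) \<longlonglongrightarrow> 0"
    "(\<lambda>k. integral\<^sup>L (lebesgue_on \<Omega>) (\<lambda>x. (norm (grad \<Omega> v x - E k x))\<^sup>2)) \<longlonglongrightarrow> 0"
    using H1_0_approx[OF \<Omega>(2) v] by blast
  have hu: "H1 \<Omega> u" and hv: "H1 \<Omega> v" using u v by (auto simp: H1_0_def)
  note L = H1_grad[OF hu] H1_grad[OF hv]
  note T = test_fun_L2[OF \<Omega>(2) a(1)] test_fun_L2[OF \<Omega>(2) b(1)]
  show ?thesis
    by (rule H1_0_limit(1)[OF \<Omega> test_fun_diff[OF a(1) b(1)] L2_on_diff[OF L(1,4)] L2_on_diff[OF L(2,5)]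
          L2_norm_diff_tendsto[OF L(1,4) T(1,3) a(2) b(2)] L2_norm_diff_tendsto[OF L(2,5) T(2,4) a(3) b(3)]])
qed

lemma test_fun_H1_0:
  assumes \<Omega>: "open \<Omega>" "\<Omega> \<in> lmeasurable" and t: "test_fun \<Omega> \<phi> D"
  shows "H1_0 \<Omega> \<phi>" "AE x in lebesgue_on \<Omega>. grad \<Omega> \<phi> x = D x"
  using H1_0_limit[OF \<Omega>, of "\<lambda>_. \<phi>" "\<lambda>_. D"] t test_fun_L2[OF \<Omega>(2) t] by auto

text \<open>The density argument between the two test classes: the pairing with \<open>g\<close> is
  continuous in the gradient. It turns the Euler equation of the minimiser into
  \<open>is_sol\<close>, and lets \<open>div_free\<close> fields be tested with differences of
  solutions.\<close>

lemma H1_0_orthogonal: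
  assumes \<Omega>: "\<Omega> \<in> lmeasurable" and g: "L2_on \<Omega> g" and v: "H1_0 \<Omega> v"
    and zero: "\<And>\<phi> D. test_fun \<Omega> \<phi> D \<Longrightarrow> integral\<^sup>L (lebesgue_on \<Omega>) (\<lambda>x. g x \<bullet> D x) = 0"
  shows "integral\<^sup>L (lebesgue_on \<Omega>) (\<lambda>x. g x \<bullet> grad \<Omega> v x) = 0"
proof -
  obtain \<phi> D where a: "\<And>k::nat. test_fun \<Omega> (\<phi> k) (D k)"
    "(\<lambda>k. integral\<^sup>L (lebesgue_on \<Omega>) (\<lambda>x. (norm (grad \<Omega> v x - D k x))\<^sup>2)) \<longlonglongrightarrow> 0"
    using H1_0_approx[OF \<Omega> v] by blast
  have "H1 \<Omega> v" using v by (simp add: H1_0_def)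
  have "(\<lambda>k. weighted_inner \<Omega> (\<lambda>x. 1) (D k) g) \<longlonglongrightarrow> weighted_inner \<Omega> (\<lambda>x. 1) (grad \<Omega> v) g"
    by (rule weighted_inner_tendsto[OF Linf_on_const test_fun_L2(2)[OF \<Omega> a(1)] H1_grad(2)[OF \<open>H1 \<Omega> v\<close>] g a(2)])
  moreover have "weighted_inner \<Omega> (\<lambda>x. 1) (D k) g = 0" for k using zero[OF a(1)] by (simp add: weighted_inner_def inner_commute)
  ultimately have "weighted_inner \<Omega> (\<lambda>x. 1) (grad \<Omega> v) g = 0" using LIMSEQ_unique[OF _ tendsto_const] by simp
  then show ?thesis by (simp add: weighted_inner_def inner_commute)
qed

section \<open>Existence of solutions\<close>

text \<open>The first-order condition at a minimum, obtained by inserting one value of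
  \<open>t\<close> instead of differentiating.\<close>

lemma quadratic_nonneg_linear_zero:
  fixes c d :: real
  assumes "\<And>t. 0 \<le> 2 * t * c + t\<^sup>2 * d" "0 \<le> d"
  shows "c = 0"
proof (rule ccontr)
  assume "c \<noteq> 0"
  \<comment> \<open>At \<open>t = - s\<close> the polynomial equals - s^2 (d + 2); the
    \<open>+ 1\<close> keeps the quotient meaningful when \<open>d = 0\<close>.\<close>
  define s where "s = c / (d + 1)"
  have c: "c = s * (d + 1)" and "s \<noteq> 0" using \<open>c \<noteq> 0\<close> assms(2) by (auto simp: s_def)
  have "0 \<le> - (s\<^sup>2 * (d + 2))" using assms(1)[of "- s"] unfolding c by (simp add: algebra_simps power2_eq_square)
  moreover have "0 < s\<^sup>2 * (d + 2)" using \<open>s \<noteq> 0\<close> assms(2) by simp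
  ultimately show False by linarith
qed

text \<open>Here \<open>g\<close> is meant to be the gradient of the boundary extension and
  \<open>z\<close> the correction with zero trace. The representative \<open>Z\<close> is returned
  alongside \<open>z\<close> because the energy limit is taken in terms of it.\<close>

lemma ex_energy_minimiser:
  fixes \<Omega> :: "'a::euclidean_space set"
  assumes \<Omega>: "open \<Omega>" "bounded \<Omega>" and a: "conductivity \<Omega> lo hi a" "0 < lo" and g: "L2_on \<Omega> g"
  obtains z Z where "H1_0 \<Omega> z" "L2_on \<Omega> Z" "AE x in lebesgue_on \<Omega>. grad \<Omega> z x = Z x"
    "\<And>\<psi> E. test_fun \<Omega> \<psi> E \<Longrightarrow> weighted_inner \<Omega> a (\<lambda>x. g x + Z x) E = 0"
proof -
  let ?M = "lebesgue_on \<Omega>"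
  have lm: "\<Omega> \<in> lmeasurable" using \<Omega> by (simp add: lmeasurable_open)
  obtain R where R: "\<And>x. x \<in> \<Omega> \<Longrightarrow> norm x \<le> R" using \<Omega>(2) by (auto simp: bounded_iff)
  have ai: "Linf_on \<Omega> a" by (rule Linf_on_conductivity[OF a])
  have alo: "AE x in ?M. lo \<le> a x" using conductivity_AE[OF a(1)] by eventually_elim simp
  have a0: "AE x in ?M. 0 \<le> a x" using alo by eventually_elim (use a(2) in simp)
  define J where "J D = weighted_inner \<Omega> a (\<lambda>x. g x + D x) (\<lambda>x. g x + D x)" for D
  define S where "S = {J D |\<phi> D. test_fun \<Omega> \<phi> D}"
  define m where "m = Inf S"
  have Sne: "S \<noteq> {}" unfolding S_def using test_fun_zero by blast
  have bdd: "bdd_below S" unfolding S_def J_def by (rule bdd_belowI[of _ 0]) (use weighted_inner_nonneg[OF a0] in blast)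
  have mle: "m \<le> J D" if "test_fun \<Omega> \<phi> D" for \<phi> D
    unfolding m_def by (rule cInf_lower[OF _ bdd]) (use that in \<open>auto simp: S_def\<close>)
  have "\<exists>\<phi> D. test_fun \<Omega> \<phi> D \<and> J D < m + inverse (real (Suc n))" for n
  proof -
    have "\<exists>y\<in>S. y < m + inverse (real (Suc n))"
      unfolding m_def by (rule cInf_lessD[OF Sne]) simp
    then show ?thesis unfolding S_def by blast
  qed
  then obtain \<phi> D where t: "\<And>n. test_fun \<Omega> (\<phi> n) (D n)" and J: "\<And>n. J (D n) < m + inverse (real (Suc n))"
    by metis
  note L = test_fun_L2[OF lm t]
  have gL: "L2_on \<Omega> (\<lambda>x. g x + D n x)" for n by (intro L2_on_add g L)
  \<comment> \<open>parallelogram identity: an approximate midpoint cannot have energy below the infimum\<close>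
  have par: "lo * integral\<^sup>L ?M (\<lambda>x. (norm (D i x - D j x))\<^sup>2) \<le> 2 * inverse (real (Suc i)) + 2 * inverse (real (Suc j))" for i j
  proof -
    let ?X = "\<lambda>x. g x + D i x" and ?Y = "\<lambda>x. g x + D j x"
    have tm: "test_fun \<Omega> (\<lambda>x. (1/2) * (\<phi> i x + \<phi> j x)) (\<lambda>x. (1/2) *\<^sub>R (D i x + D j x))"
      by (intro test_fun_scale test_fun_add t)
    have "4 * J (\<lambda>x. (1/2) *\<^sub>R (D i x + D j x)) = weighted_inner \<Omega> a (\<lambda>x. ?X x + ?Y x) (\<lambda>x. ?X x + ?Y x)"
    proof -
      have "(\<lambda>x. g x + (1/2) *\<^sub>R (D i x + D j x)) = (\<lambda>x. (1/2) *\<^sub>R (?X x + ?Y x))"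
      proof
        fix x
        have "g x = (1/2) *\<^sub>R (g x + g x)" by (simp add: scaleR_2[symmetric])
        then show "g x + (1/2) *\<^sub>R (D i x + D j x) = (1/2) *\<^sub>R (?X x + ?Y x)"
          by (simp add: scaleR_add_right)
      qed
      then show ?thesis unfolding J_def by (simp only: weighted_inner_scaleR_left weighted_inner_scaleR_right)
    qed
    then have "4 * m \<le> weighted_inner \<Omega> a (\<lambda>x. ?X x + ?Y x) (\<lambda>x. ?X x + ?Y x)" using mle[OF tm] by simp
    moreover have "weighted_inner \<Omega> a (\<lambda>x. ?X x + ?Y x) (\<lambda>x. ?X x + ?Y x) = weighted_inner \<Omega> a ?X ?X + 2 * weighted_inner \<Omega> a ?X ?Y + weighted_inner \<Omega> a ?Y ?Y"
      by (rule weighted_inner_add_self[OF ai gL gL])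
    moreover have "weighted_inner \<Omega> a (\<lambda>x. ?X x - ?Y x) (\<lambda>x. ?X x - ?Y x) = weighted_inner \<Omega> a ?X ?X - 2 * weighted_inner \<Omega> a ?X ?Y + weighted_inner \<Omega> a ?Y ?Y"
      by (rule weighted_inner_diff_self[OF ai gL gL])
    moreover have "weighted_inner \<Omega> a ?X ?X < m + inverse (real (Suc i))" "weighted_inner \<Omega> a ?Y ?Y < m + inverse (real (Suc j))"
      using J[of i] J[of j] by (simp_all add: J_def)
    moreover have "lo * integral\<^sup>L ?M (\<lambda>x. (norm (D i x - D j x))\<^sup>2) \<le> weighted_inner \<Omega> a (\<lambda>x. ?X x - ?Y x) (\<lambda>x. ?X x - ?Y x)"
      using weighted_inner_lower_bound[OF ai alo L2_on_diff[OF gL[of i] gL[of j]]] by simp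
    ultimately show ?thesis by linarith
  qed
  have CD: "\<exists>N. \<forall>i\<ge>N. \<forall>j\<ge>N. integral\<^sup>L ?M (\<lambda>x. (norm (D i x - D j x))\<^sup>2) < e" if e: "e > 0" for e
  proof -
    \<comment> \<open>Two terms, each at most 2 / (N + 1), must stay below \<open>lo * e\<close>,
      whence the factor 1/4.\<close>
    obtain N where N: "inverse (real (Suc N)) < lo * e / 4"
      using reals_Archimedean[of "lo * e / 4"] a(2) e by auto
    have "integral\<^sup>L ?M (\<lambda>x. (norm (D i x - D j x))\<^sup>2) < e" if "i \<ge> N" "j \<ge> N" for i j
    proof -
      have "inverse (real (Suc i)) \<le> inverse (real (Suc N))" "inverse (real (Suc j)) \<le> inverse (real (Suc N))"
        using that by (auto intro!: le_imp_inverse_le)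
      then have "lo * integral\<^sup>L ?M (\<lambda>x. (norm (D i x - D j x))\<^sup>2) < lo * e" using par[of i j] N by linarith
      then show ?thesis using a(2) by simp
    qed
    then show ?thesis by blast
  qed
  \<comment> \<open>The energy controls gradients only; Poincare transfers the Cauchy property to
    the functions themselves. The \<open>+ 1\<close> below avoids division by zero when
    \<open>R = 0\<close>.\<close>
  have C\<phi>: "\<exists>N. \<forall>i\<ge>N. \<forall>j\<ge>N. integral\<^sup>L ?M (\<lambda>x. (norm (\<phi> i x - \<phi> j x))\<^sup>2) < e" if e: "e > 0" for e
  proof -
    have p: "4 * R\<^sup>2 + 1 > 0" by (simp add: add_nonneg_pos)
    obtain N where N: "\<And>i j. i \<ge> N \<Longrightarrow> j \<ge> N \<Longrightarrow> integral\<^sup>L ?M (\<lambda>x. (norm (D i x - D j x))\<^sup>2) < e / (4 * R\<^sup>2 + 1)"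
      using CD[of "e / (4 * R\<^sup>2 + 1)"] e p by auto
    have "integral\<^sup>L ?M (\<lambda>x. (norm (\<phi> i x - \<phi> j x))\<^sup>2) < e" if "i \<ge> N" "j \<ge> N" for i j
    proof -
      let ?I = "integral\<^sup>L ?M (\<lambda>x. (norm (D i x - D j x))\<^sup>2)"
      have "integral\<^sup>L ?M (\<lambda>x. (norm (\<phi> i x - \<phi> j x))\<^sup>2) \<le> 4 * R\<^sup>2 * ?I"
        by (rule test_fun_Poincare[OF test_fun_diff[OF t t] lm R])
      also have "\<dots> \<le> ?I * (4 * R\<^sup>2 + 1)" by (simp add: algebra_simps)
      also have "\<dots> < e" using N[OF that] unfolding pos_less_divide_eq[OF p] .
      finally show ?thesis .
    qed
    then show ?thesis by blast
  qed
  obtain z where z: "L2_on \<Omega> z" "(\<lambda>k. integral\<^sup>L ?M (\<lambda>x. (norm (z x - \<phi> k x))\<^sup>2)) \<longlonglongrightarrow> 0"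
    using L2_on_complete[OF lm L(1) C\<phi>] by blast
  obtain Z where Z: "L2_on \<Omega> Z" "(\<lambda>k. integral\<^sup>L ?M (\<lambda>x. (norm (Z x - D k x))\<^sup>2)) \<longlonglongrightarrow> 0"
    using L2_on_complete[OF lm L(2) CD] by blast
  note zz = H1_0_limit[OF \<Omega>(1) lm t z(1) Z(1) z(2) Z(2)]
  have gZ: "L2_on \<Omega> (\<lambda>x. g x + Z x)" by (intro L2_on_add g Z)
  have Jlim: "(\<lambda>k. J (\<lambda>x. D k x + E x)) \<longlonglongrightarrow> J (\<lambda>x. Z x + E x)" if E: "L2_on \<Omega> E" for E
    unfolding J_def
  proof (rule weighted_inner_self_tendsto[OF ai])
    show "(\<lambda>k. integral\<^sup>L ?M (\<lambda>x. (norm (g x + (Z x + E x) - (g x + (D k x + E x))))\<^sup>2)) \<longlonglongrightarrow> 0"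
      using Z(2) by (simp add: algebra_simps)
  qed (intro L2_on_add g L Z E)+
  have Jm: "J Z \<le> m"
  proof (rule LIMSEQ_le)
    show "(\<lambda>k. J (D k)) \<longlonglongrightarrow> J Z" using Jlim[OF L2_on_zero] by simp
    show "(\<lambda>k. m + inverse (real (Suc k))) \<longlonglongrightarrow> m"
      using tendsto_add[OF tendsto_const LIMSEQ_inverse_real_of_nat, of m] by simp
    show "\<exists>N. \<forall>n\<ge>N. J (D n) \<le> m + inverse (real (Suc n))" using J less_imp_le by blast
  qed
  \<comment> \<open>\<open>Z\<close> itself need not be the gradient of a test function, so
    \<open>m\<close> bounds the energy of its perturbations only as a limit of the competitors
    \<open>D n + s E\<close>.\<close>
  have orth: "weighted_inner \<Omega> a (\<lambda>x. g x + Z x) E = 0" if E: "test_fun \<Omega> \<psi> E" for \<psi> E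
  proof (rule quadratic_nonneg_linear_zero)
    have EL: "L2_on \<Omega> E" by (rule test_fun_L2(2)[OF lm E])
    show "0 \<le> weighted_inner \<Omega> a E E" by (rule weighted_inner_nonneg[OF a0])
    fix s :: real
    have "m \<le> J (\<lambda>x. Z x + s *\<^sub>R E x)"
    proof (rule LIMSEQ_le_const[OF Jlim[OF L2_on_scaleR[OF EL, of s]]])
      show "\<exists>N. \<forall>n\<ge>N. m \<le> J (\<lambda>x. D n x + s *\<^sub>R E x)"
        using mle[OF test_fun_add[OF t test_fun_scale[OF E]]] by blast
    qed
    also have "J (\<lambda>x. Z x + s *\<^sub>R E x) = J Z + 2 * s * weighted_inner \<Omega> a (\<lambda>x. g x + Z x) E + s\<^sup>2 * weighted_inner \<Omega> a E E"
      using weighted_inner_add_self[OF ai gZ L2_on_scaleR[OF EL, of s]]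
      by (simp add: J_def weighted_inner_scaleR_left weighted_inner_scaleR_right power2_eq_square add.assoc)
    finally show "0 \<le> 2 * s * weighted_inner \<Omega> a (\<lambda>x. g x + Z x) E + s\<^sup>2 * weighted_inner \<Omega> a E E" using Jm by linarith
  qed
  show ?thesis by (rule that[OF zz(1) Z(1) zz(2) orth])
qed

text \<open>Adding the zero-trace minimiser to the extension \<open>F\<close> gives a solution, so
  the Hilbert choice in \<open>sol\<close> picks a genuine one.\<close>

lemma is_sol_sol:
  assumes \<Omega>: "open \<Omega>" "bounded \<Omega>" and a: "conductivity \<Omega> lo hi a" "0 < lo" and F: "H1 \<Omega> F"
  shows "is_sol \<Omega> a F (sol \<Omega> a F)"
proof -
  have lm: "\<Omega> \<in> lmeasurable" using \<Omega> by (simp add: lmeasurable_open)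
  have ai: "Linf_on \<Omega> a" by (rule Linf_on_conductivity[OF a])
  note gF = H1_grad[OF F]
  obtain z Z where z: "H1_0 \<Omega> z" "L2_on \<Omega> Z" "AE x in lebesgue_on \<Omega>. grad \<Omega> z x = Z x"
    "\<And>\<psi> E. test_fun \<Omega> \<psi> E \<Longrightarrow> weighted_inner \<Omega> a (\<lambda>x. grad \<Omega> F x + Z x) E = 0"
    using ex_energy_minimiser[OF \<Omega> a gF(2)] by blast
  have zH: "H1 \<Omega> z" using z(1) by (simp add: H1_0_def)
  let ?u = "\<lambda>x. F x + z x"
  note u = H1_add[OF \<Omega>(1) lm F zH]
  have gu: "AE x in lebesgue_on \<Omega>. grad \<Omega> ?u x = grad \<Omega> F x + Z x"
    using u(2) z(3) by eventually_elim simp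
  note uL = H1_grad(2)[OF u(1)]
  have "is_sol \<Omega> a F ?u"
    unfolding is_sol_def
  proof (intro conjI allI impI)
    show "H1 \<Omega> ?u" by (rule u(1))
    show "H1_0 \<Omega> (\<lambda>x. F x + z x - F x)" using z(1) by simp
    fix v assume v: "H1_0 \<Omega> v"
    have "integral\<^sup>L (lebesgue_on \<Omega>) (\<lambda>x. (a x *\<^sub>R grad \<Omega> ?u x) \<bullet> grad \<Omega> v x) = 0"
    proof (rule H1_0_orthogonal[OF lm L2_on_scaleR_Linf[OF ai uL] v])
      fix \<psi> E assume t: "test_fun \<Omega> \<psi> E"
      note EL = test_fun_L2(2)[OF lm t]
      have "weighted_inner \<Omega> a (grad \<Omega> ?u) E = weighted_inner \<Omega> a (\<lambda>x. grad \<Omega> F x + Z x) E"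
        by (rule weighted_inner_cong_AE[OF ai uL L2_on_add[OF gF(2) z(2)] EL EL gu]) simp
      then show "integral\<^sup>L (lebesgue_on \<Omega>) (\<lambda>x. (a x *\<^sub>R grad \<Omega> ?u x) \<bullet> E x) = 0"
        using z(4)[OF t] by (simp add: weighted_inner_def)
    qed
    then show "integral\<^sup>L (lebesgue_on \<Omega>) (\<lambda>x. a x * (grad \<Omega> ?u x \<bullet> grad \<Omega> v x)) = 0" by simp
  qed
  then show ?thesis unfolding sol_def by (rule someI[of "is_sol \<Omega> a F"])
qed

section \<open>The remainder form\<close>

lemma weighted_inner_sol_zero_boundary:
  assumes "is_sol \<Omega> a F u" "H1_0 \<Omega> v"
  shows "weighted_inner \<Omega> a (grad \<Omega> u) (grad \<Omega> v) = 0"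
  using assms by (simp add: is_sol_def weighted_inner_def)

text \<open>\<open>v\<close> and \<open>w\<close> share their boundary data, so their difference
  lies in H^1_0 and is annihilated by the equation for \<open>u\<close>, whatever coefficients
  \<open>v\<close> and \<open>w\<close> belong to. This identifies mixed pairings of solutions with
  values of \<open>DN\<close>.\<close>

lemma weighted_inner_sol_same_boundary:
  assumes \<Omega>: "open \<Omega>" "\<Omega> \<in> lmeasurable" and a: "Linf_on \<Omega> a"
    and u: "is_sol \<Omega> a F u" and v: "is_sol \<Omega> b G v" and w: "is_sol \<Omega> c G w"
  shows "weighted_inner \<Omega> a (grad \<Omega> u) (grad \<Omega> v) = weighted_inner \<Omega> a (grad \<Omega> u) (grad \<Omega> w)"
proof -
  have H: "H1 \<Omega> u" "H1 \<Omega> v" "H1 \<Omega> w" using u v w by (auto simp: is_sol_def)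
  have "H1_0 \<Omega> (\<lambda>x. (v x - G x) - (w x - G x))"
    by (rule H1_0_diff[OF \<Omega>]) (use v w in \<open>auto simp: is_sol_def\<close>)
  then have d: "H1_0 \<Omega> (\<lambda>x. v x - w x)" by simp
  note L = H1_grad(2)[OF H(1)] H1_grad(2)[OF H(2)] H1_grad(2)[OF H(3)] H1_grad(2)[OF H1_diff(1)[OF \<Omega> H(2,3)]]
  have "0 = weighted_inner \<Omega> a (grad \<Omega> u) (grad \<Omega> (\<lambda>x. v x - w x))"
    using weighted_inner_sol_zero_boundary[OF u d] by simp
  also have "\<dots> = weighted_inner \<Omega> a (grad \<Omega> u) (\<lambda>x. grad \<Omega> v x - grad \<Omega> w x)"
    by (rule weighted_inner_cong_AE[OF a L(1) L(1) L(4) L2_on_diff[OF L(2,3)] _ H1_diff(2)[OF \<Omega> H(2,3)]]) simp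
  also have "\<dots> = weighted_inner \<Omega> a (grad \<Omega> u) (grad \<Omega> v) - weighted_inner \<Omega> a (grad \<Omega> u) (grad \<Omega> w)"
    by (rule weighted_inner_diff_right[OF a L(2,3,1)])
  finally show ?thesis by simp
qed

lemma Bform_le:
  assumes \<Omega>: "open \<Omega>" "bounded \<Omega>" and a: "conductivity \<Omega> lo hi a" and d: "conductivity \<Omega> lo hi d" and lo: "0 < lo"
    and F: "H1 \<Omega> F" and w: "L2_on \<Omega> w" "div_free \<Omega> (\<lambda>x. sqrt (d x) *\<^sub>R w x)"
  shows "Bform \<Omega> a d F F \<le> integral\<^sup>L (lebesgue_on \<Omega>)
     (\<lambda>x. (norm (((a x - d x) / sqrt (d x)) *\<^sub>R grad \<Omega> (sol \<Omega> a F) x - w x))\<^sup>2)"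
proof -
  have lm: "\<Omega> \<in> lmeasurable" using \<Omega> by (simp add: lmeasurable_open)
  note ai = Linf_on_conductivity[OF a lo] and di = Linf_on_conductivity[OF d lo]
  note sd = Linf_on_sqrt_conductivity[OF d lo] and isd = Linf_on_inverse_sqrt_conductivity[OF d lo]
  define u where "u = sol \<Omega> a F"
  define v where "v = sol \<Omega> d F"
  have su: "is_sol \<Omega> a F u" and sv: "is_sol \<Omega> d F v"
    unfolding u_def v_def by (rule is_sol_sol[OF \<Omega> a lo F], rule is_sol_sol[OF \<Omega> d lo F])
  have Hu: "H1 \<Omega> u" and Hv: "H1 \<Omega> v" using su sv by (auto simp: is_sol_def)
  let ?U = "grad \<Omega> u" and ?V = "grad \<Omega> v"
  let ?Z = "\<lambda>x. ?U x - ?V x"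
  note U = H1_grad(2)[OF Hu] and V = H1_grad(2)[OF Hv]
  note Z = L2_on_diff[OF U V]
  have "H1_0 \<Omega> (\<lambda>x. (u x - F x) - (v x - F x))"
    by (rule H1_0_diff[OF \<Omega>(1) lm]) (use su sv in \<open>auto simp: is_sol_def\<close>)
  then have z: "H1_0 \<Omega> (\<lambda>x. u x - v x)" by simp
  note gz = H1_diff[OF \<Omega>(1) lm Hu Hv]
  \<comment> \<open>Each solution is energy-orthogonal, in its own weight, to the difference
    \<open>?Z\<close>; the remaining pairing of \<open>?U\<close> with \<open>?Z\<close> in weight
    \<open>d\<close> thereby becomes the energy of \<open>?Z\<close>.\<close>
  have aUZ: "weighted_inner \<Omega> a ?U ?Z = 0"
    using weighted_inner_sol_same_boundary[OF \<Omega>(1) lm ai su su sv] weighted_inner_diff_right[OF ai U V U] by simp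
  have dVZ: "weighted_inner \<Omega> d ?V ?Z = 0"
    using weighted_inner_sol_same_boundary[OF \<Omega>(1) lm di sv su sv] weighted_inner_diff_right[OF di U V V] by simp
  have dUZ: "weighted_inner \<Omega> d ?U ?Z = weighted_inner \<Omega> d ?Z ?Z"
    using weighted_inner_diff_left[OF di U V Z] dVZ by simp
  have B: "Bform \<Omega> a d F F = weighted_inner \<Omega> d ?Z ?Z"
  proof -
    have "Bform \<Omega> a d F F = weighted_inner \<Omega> a ?U ?U - weighted_inner \<Omega> d ?V ?V - weighted_inner \<Omega> (\<lambda>x. a x - d x) ?U ?U"
      by (simp add: Bform_def DN_def DNd_def weighted_inner_def u_def v_def)
    also have "\<dots> = weighted_inner \<Omega> d ?U ?U - weighted_inner \<Omega> d ?V ?V"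
      using weighted_inner_diff_weight[OF ai di U U] by simp
    \<comment> \<open>By \<open>dVZ\<close> the energy of \<open>?V\<close> equals its pairing with
      \<open>?U\<close>, so the difference of energies collapses to a single pairing.\<close>
    also have "\<dots> = weighted_inner \<Omega> d ?U ?Z"
      using weighted_inner_diff_right[OF di U V U] weighted_inner_diff_right[OF di U V V] dVZ by (simp add: weighted_inner_commute[of \<Omega> d ?V ?U])
    finally show ?thesis using dUZ by simp
  qed
  let ?c = "\<lambda>x. (a x - d x) / sqrt (d x)"
  have ci: "Linf_on \<Omega> ?c" using Linf_on_mult[OF Linf_on_diff[OF ai di] isd] by simp
  let ?X = "\<lambda>x. ?c x *\<^sub>R ?U x - w x" and ?Y = "\<lambda>x. sqrt (d x) *\<^sub>R ?Z x"
  note one = Linf_on_const[of \<Omega> 1]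
  note cU = L2_on_scaleR_Linf[OF ci U]
  note X = L2_on_diff[OF cU w(1)] and Y = L2_on_scaleR_Linf[OF sd Z]
  have dpos: "AE x in lebesgue_on \<Omega>. 0 < d x"
    using conductivity_AE[OF d] by eventually_elim (use lo in linarith)
  have YY: "weighted_inner \<Omega> (\<lambda>x. 1) ?Y ?Y = weighted_inner \<Omega> d ?Z ?Z"
    unfolding weighted_inner_scaleR_weights
    by (rule weighted_inner_cong_weight[OF Linf_on_measurable[OF Linf_on_mult[OF sd sd]] Linf_on_measurable[OF di] Z Z])
       (use dpos in \<open>auto elim!: eventually_mono\<close>)
  \<comment> \<open>The factor sqrt d moves from \<open>?Y\<close> to \<open>w\<close>, producing
    the divergence-free field, which density allows to be tested with \<open>u - v\<close>.\<close>
  have wY: "weighted_inner \<Omega> (\<lambda>x. 1) w ?Y = 0"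
  proof -
    have "integral\<^sup>L (lebesgue_on \<Omega>) (\<lambda>x. (sqrt (d x) *\<^sub>R w x) \<bullet> grad \<Omega> (\<lambda>x. u x - v x) x) = 0"
      by (rule H1_0_orthogonal[OF lm L2_on_scaleR_Linf[OF sd w(1)] z]) (use w(2) in \<open>simp add: div_free_def\<close>)
    then have "0 = weighted_inner \<Omega> (\<lambda>x. sqrt (d x)) w (grad \<Omega> (\<lambda>x. u x - v x))" by (simp add: weighted_inner_def)
    also have "\<dots> = weighted_inner \<Omega> (\<lambda>x. sqrt (d x)) w ?Z"
      by (rule weighted_inner_cong_AE[OF sd w(1) w(1) H1_grad(2)[OF gz(1)] Z _ gz(2)]) simp
    finally show ?thesis by (simp add: weighted_inner_def)
  qed
  \<comment> \<open>The weights multiply to \<open>a - d\<close>. The \<open>a\<close> part vanishes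
    because \<open>u\<close> solves the \<open>a\<close> equation, leaving minus the
    \<open>d\<close> pairing.\<close>
  have cUY: "weighted_inner \<Omega> (\<lambda>x. 1) (\<lambda>x. ?c x *\<^sub>R ?U x) ?Y = - weighted_inner \<Omega> d ?Z ?Z"
  proof -
    have "weighted_inner \<Omega> (\<lambda>x. 1) (\<lambda>x. ?c x *\<^sub>R ?U x) ?Y = weighted_inner \<Omega> (\<lambda>x. a x - d x) ?U ?Z"
      unfolding weighted_inner_scaleR_weights
      by (rule weighted_inner_cong_weight[OF Linf_on_measurable[OF Linf_on_mult[OF ci sd]] Linf_on_measurable[OF Linf_on_diff[OF ai di]] U Z])
         (use dpos in \<open>auto elim!: eventually_mono\<close>)
    then show ?thesis using weighted_inner_diff_weight[OF ai di U Z] aUZ dUZ by simp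
  qed
  have "0 \<le> weighted_inner \<Omega> (\<lambda>x. 1) (\<lambda>x. ?X x + ?Y x) (\<lambda>x. ?X x + ?Y x)" by (rule weighted_inner_nonneg) simp
  also have "\<dots> = weighted_inner \<Omega> (\<lambda>x. 1) ?X ?X + 2 * weighted_inner \<Omega> (\<lambda>x. 1) ?X ?Y + weighted_inner \<Omega> (\<lambda>x. 1) ?Y ?Y"
    by (rule weighted_inner_add_self[OF one X Y])
  also have "weighted_inner \<Omega> (\<lambda>x. 1) ?X ?Y = - weighted_inner \<Omega> d ?Z ?Z"
    using weighted_inner_diff_left[OF one cU w(1) Y] wY cUY by simp
  finally have "weighted_inner \<Omega> d ?Z ?Z \<le> weighted_inner \<Omega> (\<lambda>x. 1) ?X ?X" using YY by simp
  then show ?thesis unfolding B weighted_inner_one_eq u_def .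
qed

text \<open>The coefficient may differ from \<open>a\<close> on a null set: products such as
  \<open>sqrt (d x) * sqrt (d x)\<close> equal \<open>d x\<close> only where \<open>d\<close> is
  nonnegative, which is known almost everywhere.\<close>

lemma div_free_sol:
  assumes \<Omega>: "open \<Omega>" "\<Omega> \<in> lmeasurable" and a: "Linf_on \<Omega> a" and u: "is_sol \<Omega> a F u"
    and b: "b \<in> borel_measurable (lebesgue_on \<Omega>)" and ab: "AE x in lebesgue_on \<Omega>. b x = a x"
  shows "div_free \<Omega> (\<lambda>x. b x *\<^sub>R grad \<Omega> u x)"
  unfolding div_free_def
proof (intro allI impI)
  fix \<phi> D assume t: "test_fun \<Omega> \<phi> D"
  have U: "L2_on \<Omega> (grad \<Omega> u)" using u H1_grad(2) by (auto simp: is_sol_def)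
  note T = test_fun_L2(2)[OF \<Omega>(2) t] and H = test_fun_H1_0[OF \<Omega> t]
  have P: "L2_on \<Omega> (grad \<Omega> \<phi>)" using H(1) H1_grad(2) by (auto simp: H1_0_def)
  have "weighted_inner \<Omega> b (grad \<Omega> u) D = weighted_inner \<Omega> a (grad \<Omega> u) D"
    by (rule weighted_inner_cong_weight[OF b Linf_on_measurable[OF a] U T ab])
  also have "\<dots> = weighted_inner \<Omega> a (grad \<Omega> u) (grad \<Omega> \<phi>)"
    by (rule weighted_inner_cong_AE[OF a U U T P]) (use H(2) in \<open>auto elim!: eventually_mono\<close>)
  also have "\<dots> = 0" by (rule weighted_inner_sol_zero_boundary[OF u H(1)])
  finally show "integral\<^sup>L (lebesgue_on \<Omega>) (\<lambda>x. (b x *\<^sub>R grad \<Omega> u x) \<bullet> D x) = 0" by (simp add: weighted_inner_def)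
qed

text \<open>The common core of (ii) and (iii): \<open>w\<close> is \<open>b\<close> times the
  gradient of a \<open>c\<close>-solution, with \<open>b\<close> equal to c / sqrt d almost
  everywhere, so that sqrt d w is the flux of that solution. Taking \<open>c = d\<close> leads to
  (ii) and \<open>c = a\<close> to (iii).\<close>

lemma Bform_le_weighted:
  assumes \<Omega>: "open \<Omega>" "bounded \<Omega>" and a: "conductivity \<Omega> lo hi a" and d: "conductivity \<Omega> lo hi d" and lo: "0 < lo"
    and F: "H1 \<Omega> F" and b: "Linf_on \<Omega> b" and c: "conductivity \<Omega> lo hi c" and h: "is_sol \<Omega> c G h"
    and bc: "AE x in lebesgue_on \<Omega>. sqrt (d x) * b x = c x"
  shows "Bform \<Omega> a d F F \<le> DNd \<Omega> a (\<lambda>x. \<bar>a x - d x\<bar>\<^sup>2 / d x) F F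
      - 2 * weighted_inner \<Omega> (\<lambda>x. (a x - d x) * c x / d x) (grad \<Omega> (sol \<Omega> a F)) (grad \<Omega> h)
      + weighted_inner \<Omega> (\<lambda>x. (c x)\<^sup>2 / d x) (grad \<Omega> h) (grad \<Omega> h)"
proof -
  have lm: "\<Omega> \<in> lmeasurable" using \<Omega> by (simp add: lmeasurable_open)
  note ai = Linf_on_conductivity[OF a lo] and di = Linf_on_conductivity[OF d lo] and cdi = Linf_on_conductivity[OF c lo]
  note sd = Linf_on_sqrt_conductivity[OF d lo] and isd = Linf_on_inverse_sqrt_conductivity[OF d lo]
  let ?U = "grad \<Omega> (sol \<Omega> a F)" and ?H = "grad \<Omega> h"
  have U: "L2_on \<Omega> ?U" using is_sol_sol[OF \<Omega> a lo F] H1_grad(2) by (auto simp: is_sol_def)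
  have H: "L2_on \<Omega> ?H" using h H1_grad(2) by (auto simp: is_sol_def)
  let ?c = "\<lambda>x. (a x - d x) / sqrt (d x)"
  have ci: "Linf_on \<Omega> ?c" using Linf_on_mult[OF Linf_on_diff[OF ai di] isd] by simp
  have [measurable]: "a \<in> borel_measurable (lebesgue_on \<Omega>)" "b \<in> borel_measurable (lebesgue_on \<Omega>)"
    "c \<in> borel_measurable (lebesgue_on \<Omega>)" "d \<in> borel_measurable (lebesgue_on \<Omega>)"
    using ai b cdi di by (auto intro: Linf_on_measurable)
  have dpos: "AE x in lebesgue_on \<Omega>. 0 < d x"
    using conductivity_AE[OF d] by eventually_elim (use lo in linarith)
  have "div_free \<Omega> (\<lambda>x. (sqrt (d x) * b x) *\<^sub>R ?H x)"
    by (rule div_free_sol[OF \<Omega>(1) lm cdi h _ bc]) measurable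
  then have df: "div_free \<Omega> (\<lambda>x. sqrt (d x) *\<^sub>R (b x *\<^sub>R ?H x))" by simp
  have bs: "AE x in lebesgue_on \<Omega>. b x = c x / sqrt (d x)"
    using bc dpos by eventually_elim (auto simp: field_simps)
  have "Bform \<Omega> a d F F \<le> weighted_inner \<Omega> (\<lambda>x. 1) (\<lambda>x. ?c x *\<^sub>R ?U x - b x *\<^sub>R ?H x) (\<lambda>x. ?c x *\<^sub>R ?U x - b x *\<^sub>R ?H x)"
    using Bform_le[OF \<Omega> a d lo F L2_on_scaleR_Linf[OF b H] df] unfolding weighted_inner_one_eq .
  also have "\<dots> = weighted_inner \<Omega> (\<lambda>x. ?c x * ?c x) ?U ?U - 2 * weighted_inner \<Omega> (\<lambda>x. ?c x * b x) ?U ?H + weighted_inner \<Omega> (\<lambda>x. b x * b x) ?H ?H"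
    using weighted_inner_diff_self[OF Linf_on_const L2_on_scaleR_Linf[OF ci U] L2_on_scaleR_Linf[OF b H]]
    by (simp only: weighted_inner_scaleR_weights)
  also have "weighted_inner \<Omega> (\<lambda>x. ?c x * ?c x) ?U ?U = weighted_inner \<Omega> (\<lambda>x. \<bar>a x - d x\<bar>\<^sup>2 / d x) ?U ?U"
  proof (rule weighted_inner_cong_weight[OF _ _ U U])
    show "AE x in lebesgue_on \<Omega>. ?c x * ?c x = \<bar>a x - d x\<bar>\<^sup>2 / d x"
      using dpos by eventually_elim (simp add: power2_eq_square)
  qed measurable
  also have "weighted_inner \<Omega> (\<lambda>x. ?c x * b x) ?U ?H = weighted_inner \<Omega> (\<lambda>x. (a x - d x) * c x / d x) ?U ?H"
  proof (rule weighted_inner_cong_weight[OF _ _ U H])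
    show "AE x in lebesgue_on \<Omega>. ?c x * b x = (a x - d x) * c x / d x"
      using dpos bs by eventually_elim simp
  qed measurable
  also have "weighted_inner \<Omega> (\<lambda>x. b x * b x) ?H ?H = weighted_inner \<Omega> (\<lambda>x. (c x)\<^sup>2 / d x) ?H ?H"
  proof (rule weighted_inner_cong_weight[OF _ _ H H])
    show "AE x in lebesgue_on \<Omega>. b x * b x = (c x)\<^sup>2 / d x"
      using dpos bs by eventually_elim (simp add: power2_eq_square)
  qed measurable
  finally show ?thesis by (simp add: DNd_def weighted_inner_def)
qed

theorem theorem2:
  fixes \<Omega> :: "'a::euclidean_space set" and lo hi :: real
    and I :: "nat set" and fam :: "nat \<Rightarrow> 'a \<Rightarrow> real"
    and \<gamma> \<gamma>d :: "'a \<Rightarrow> real"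
  assumes "lipschitz_domain \<Omega>" and "0 < lo" and "lo \<le> hi"
    and "orthonormal_fam \<Omega> I fam"
    and "in_DF \<Omega> lo hi I fam \<gamma>" and "in_DF \<Omega> lo hi I fam \<gamma>d"
    and "\<exists>c<1. AE x in lebesgue_on \<Omega>. \<bar>\<gamma> x - \<gamma>d x\<bar> / \<gamma>d x \<le> c"
  shows
    "(\<forall>F. H1 \<Omega> F \<longrightarrow>
        Bform \<Omega> \<gamma> \<gamma>d F F \<le>
          Inf {integral\<^sup>L (lebesgue_on \<Omega>)
                 (\<lambda>x. (norm (((\<gamma> x - \<gamma>d x) / sqrt (\<gamma>d x)) *\<^sub>R grad \<Omega> (sol \<Omega> \<gamma> F) x - w x))\<^sup>2)
               | w. L2_on \<Omega> w \<and> div_free \<Omega> (\<lambda>x. sqrt (\<gamma>d x) *\<^sub>R w x)})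
     \<and> (\<forall>F G. H1 \<Omega> F \<longrightarrow> H1 \<Omega> G \<longrightarrow>
        Bform \<Omega> \<gamma> \<gamma>d F F \<le>
          DNd \<Omega> \<gamma> (\<lambda>x. \<bar>\<gamma> x - \<gamma>d x\<bar>\<^sup>2 / \<gamma>d x) F F
          - 2 * (DN \<Omega> \<gamma> F G - DN \<Omega> \<gamma>d F G) + DN \<Omega> \<gamma>d G G)
     \<and> (\<forall>F G. H1 \<Omega> F \<longrightarrow> H1 \<Omega> G \<longrightarrow>
        Bform \<Omega> \<gamma> \<gamma>d F F \<le>
          DNd \<Omega> \<gamma> (\<lambda>x. \<bar>\<gamma> x - \<gamma>d x\<bar>\<^sup>2 / \<gamma>d x) F F
          - 2 * DNd \<Omega> \<gamma> (\<lambda>x. (\<gamma> x - \<gamma>d x) * \<gamma> x / \<gamma>d x) F G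
          + DNd \<Omega> \<gamma> (\<lambda>x. (\<gamma> x)\<^sup>2 / \<gamma>d x) G G)"
proof (intro conjI allI impI)
  have \<Omega>: "open \<Omega>" "bounded \<Omega>" using assms(1) by (auto simp: lipschitz_domain_def)
  have lm: "\<Omega> \<in> lmeasurable" using \<Omega> by (simp add: lmeasurable_open)
  note lo = assms(2)
  have g: "conductivity \<Omega> lo hi \<gamma>" and d: "conductivity \<Omega> lo hi \<gamma>d"
    using assms(5,6) by (auto simp: in_DF_def)
  note gi = Linf_on_conductivity[OF g lo] and di = Linf_on_conductivity[OF d lo]
  note sd = Linf_on_sqrt_conductivity[OF d lo] and isd = Linf_on_inverse_sqrt_conductivity[OF d lo]
  have dpos: "AE x in lebesgue_on \<Omega>. 0 < \<gamma>d x"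
    using conductivity_AE[OF d] by eventually_elim (use lo in linarith)
  {
    fix F assume F: "H1 \<Omega> F"
    let ?S = "{integral\<^sup>L (lebesgue_on \<Omega>)
                 (\<lambda>x. (norm (((\<gamma> x - \<gamma>d x) / sqrt (\<gamma>d x)) *\<^sub>R grad \<Omega> (sol \<Omega> \<gamma> F) x - w x))\<^sup>2)
               | w. L2_on \<Omega> w \<and> div_free \<Omega> (\<lambda>x. sqrt (\<gamma>d x) *\<^sub>R w x)}"
    show "Bform \<Omega> \<gamma> \<gamma>d F F \<le> Inf ?S"
    proof (rule cInf_greatest)
      \<comment> \<open>A real infimum is a greatest lower bound only over a nonempty set; the zero
        field is a member.\<close>
      have "L2_on \<Omega> (\<lambda>x. 0::'a) \<and> div_free \<Omega> (\<lambda>x. sqrt (\<gamma>d x) *\<^sub>R (0::'a))"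
        by (simp add: L2_on_zero div_free_def)
      then show "?S \<noteq> {}" by blast
      show "Bform \<Omega> \<gamma> \<gamma>d F F \<le> y" if "y \<in> ?S" for y
        using that Bform_le[OF \<Omega> g d lo F] by blast
    qed
  }
  fix F G assume F: "H1 \<Omega> F" and G: "H1 \<Omega> G"
  note gF = is_sol_sol[OF \<Omega> g lo F] and gG = is_sol_sol[OF \<Omega> g lo G]
    and dF = is_sol_sol[OF \<Omega> d lo F] and dG = is_sol_sol[OF \<Omega> d lo G]
  have L: "L2_on \<Omega> (grad \<Omega> (sol \<Omega> \<gamma> F))" "L2_on \<Omega> (grad \<Omega> (sol \<Omega> \<gamma>d G))"
    using gF dG H1_grad(2) by (auto simp: is_sol_def)
  have [measurable]: "\<gamma> \<in> borel_measurable (lebesgue_on \<Omega>)" "\<gamma>d \<in> borel_measurable (lebesgue_on \<Omega>)"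
    using gi di by (auto intro: Linf_on_measurable)
  show "Bform \<Omega> \<gamma> \<gamma>d F F \<le> DNd \<Omega> \<gamma> (\<lambda>x. \<bar>\<gamma> x - \<gamma>d x\<bar>\<^sup>2 / \<gamma>d x) F F
          - 2 * (DN \<Omega> \<gamma> F G - DN \<Omega> \<gamma>d F G) + DN \<Omega> \<gamma>d G G"
  proof -
    let ?U = "grad \<Omega> (sol \<Omega> \<gamma> F)" and ?H = "grad \<Omega> (sol \<Omega> \<gamma>d G)"
    have "AE x in lebesgue_on \<Omega>. sqrt (\<gamma>d x) * sqrt (\<gamma>d x) = \<gamma>d x" using dpos by eventually_elim simp
    note main = Bform_le_weighted[OF \<Omega> g d lo F sd d dG this]
    have "weighted_inner \<Omega> (\<lambda>x. (\<gamma> x - \<gamma>d x) * \<gamma>d x / \<gamma>d x) ?U ?H = weighted_inner \<Omega> (\<lambda>x. \<gamma> x - \<gamma>d x) ?U ?H"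
    proof (rule weighted_inner_cong_weight[OF _ _ L])
      show "AE x in lebesgue_on \<Omega>. (\<gamma> x - \<gamma>d x) * \<gamma>d x / \<gamma>d x = \<gamma> x - \<gamma>d x"
        using dpos by eventually_elim simp
    qed measurable
    also have "\<dots> = weighted_inner \<Omega> \<gamma> ?U ?H - weighted_inner \<Omega> \<gamma>d ?U ?H" by (rule weighted_inner_diff_weight[OF gi di L])
    \<comment> \<open>Paired in weight \<gamma> with a \<gamma>-solution, the \<gamma>d-solution for
      \<open>G\<close> may be replaced by the \<gamma>-solution with the same data. In weight
      \<gamma>d the roles are reversed, and the solution for \<open>F\<close> is the one
      replaced.\<close>
    also have "weighted_inner \<Omega> \<gamma> ?U ?H = DN \<Omega> \<gamma> F G"
      unfolding weighted_inner_sol_same_boundary[OF \<Omega>(1) lm gi gF dG gG] by (simp add: DN_def weighted_inner_def)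
    also have "weighted_inner \<Omega> \<gamma>d ?U ?H = DN \<Omega> \<gamma>d F G"
      unfolding weighted_inner_commute[of \<Omega> \<gamma>d ?U] weighted_inner_sol_same_boundary[OF \<Omega>(1) lm di dG gF dF]
      by (simp add: DN_def weighted_inner_def inner_commute)
    finally have 1: "weighted_inner \<Omega> (\<lambda>x. (\<gamma> x - \<gamma>d x) * \<gamma>d x / \<gamma>d x) ?U ?H = DN \<Omega> \<gamma> F G - DN \<Omega> \<gamma>d F G" .
    have "weighted_inner \<Omega> (\<lambda>x. (\<gamma>d x)\<^sup>2 / \<gamma>d x) ?H ?H = weighted_inner \<Omega> \<gamma>d ?H ?H"
    proof (rule weighted_inner_cong_weight[OF _ _ L(2) L(2)])
      show "AE x in lebesgue_on \<Omega>. (\<gamma>d x)\<^sup>2 / \<gamma>d x = \<gamma>d x"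
        using dpos by eventually_elim (simp add: power2_eq_square)
    qed measurable
    then have 2: "weighted_inner \<Omega> (\<lambda>x. (\<gamma>d x)\<^sup>2 / \<gamma>d x) ?H ?H = DN \<Omega> \<gamma>d G G" by (simp add: DN_def weighted_inner_def)
    show ?thesis using main unfolding 1 2 .
  qed
  show "Bform \<Omega> \<gamma> \<gamma>d F F \<le> DNd \<Omega> \<gamma> (\<lambda>x. \<bar>\<gamma> x - \<gamma>d x\<bar>\<^sup>2 / \<gamma>d x) F F
          - 2 * DNd \<Omega> \<gamma> (\<lambda>x. (\<gamma> x - \<gamma>d x) * \<gamma> x / \<gamma>d x) F G
          + DNd \<Omega> \<gamma> (\<lambda>x. (\<gamma> x)\<^sup>2 / \<gamma>d x) G G"
  proof -
    have "Linf_on \<Omega> (\<lambda>x. \<gamma> x / sqrt (\<gamma>d x))" using Linf_on_mult[OF gi isd] by simp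
    moreover have "AE x in lebesgue_on \<Omega>. sqrt (\<gamma>d x) * (\<gamma> x / sqrt (\<gamma>d x)) = \<gamma> x"
      using dpos by eventually_elim simp
    ultimately show ?thesis
      using Bform_le_weighted[OF \<Omega> g d lo F _ g gG] unfolding DNd_def weighted_inner_def by blast
  qed
qed

end
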